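(* The following are equivalent for an integral domain $D$: (1) for every nonzero nonunit $x$ of $D$, $xD$ is a $\ast$-product of finitely many $\ast$-af-homog ideals; (2) $D$ is an almost GCD domain that is a $\ast$-IRKT.
   Context: $\ast$ is a star operation on $D$ of finite character. A $\ast$-ideal is a nonzero fractional ideal $I$ with $I^\ast=I$; of finite type if $I=J^\ast$ for some nonzero finitely generated $J$. A maximal $\ast$-ideal is an integral $\ast$-ideal maximal among proper integral $\ast$-ideals. The $\ast$-product of $I_1,\dots,I_n$ is $(I_1\cdots I_n)^\ast$. A $\ast$-homog ideal is a proper integral $\ast$-ideal $I$ of finite type such that $(A+B)^\ast\neq D$ for every pair $A,B$ of proper integral $\ast$-ideals of finite type containing $I$. A $\ast$-af-homog ideal is a $\ast$-homog ideal $I$ such that for every $\ast$-ideal $J$ of finite type containing $I$ there is $n\ge1$ with $(J^n)^\ast$ principal. $D$ is a $\ast$-IRKT if $D_P$ is a valuation domain for every maximal $\ast$-ideal $P$, $D=\bigcap_P D_P$ over the maximal $\ast$-ideals with the intersection locally finite, and no two distinct maximal $\ast$-ideals contain a common nonzero prime ideal. $D$ is an almost GCD domain if for every pair $a,b$ of nonzero elements there is $n\ge1$ with $a^nD\cap b^nD$ principal. *)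

theory Defs
  imports Main
begin

text \<open>Integral domain D, represented as a subring of a field of type 'a that is its
  quotient field.\<close>

definition is_domain_with_qf :: "('a::field) set \<Rightarrow> bool" where
  "is_domain_with_qf D \<longleftrightarrow> 0 \<in> D \<and> 1 \<in> D \<and>
     (\<forall>a\<in>D. \<forall>b\<in>D. a + b \<in> D \<and> a - b \<in> D \<and> a * b \<in> D) \<and>
     (\<forall>z. \<exists>a\<in>D. \<exists>b\<in>D. b \<noteq> 0 \<and> z = a / b)"

definition principal :: "('a::field) \<Rightarrow> 'a set \<Rightarrow> 'a set" where
  "principal x D = (\<lambda>d. x * d) ` D"

definition is_unit_in :: "('a::field) set \<Rightarrow> 'a \<Rightarrow> bool" where
  "is_unit_in D x \<longleftrightarrow> x \<in> D \<and> x \<noteq> 0 \<and> inverse x \<in> D"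

definition submodule :: "('a::field) set \<Rightarrow> 'a set \<Rightarrow> bool" where
  "submodule D I \<longleftrightarrow> 0 \<in> I \<and> (\<forall>x\<in>I. \<forall>y\<in>I. x + y \<in> I) \<and> (\<forall>d\<in>D. \<forall>x\<in>I. d * x \<in> I)"

definition frac_ideal :: "('a::field) set \<Rightarrow> 'a set \<Rightarrow> bool" where
  "frac_ideal D I \<longleftrightarrow> submodule D I \<and> I \<noteq> {0} \<and>
     (\<exists>d\<in>D. d \<noteq> 0 \<and> (\<forall>x\<in>I. d * x \<in> D))"

definition dspan :: "('a::field) set \<Rightarrow> 'a set \<Rightarrow> 'a set" where
  "dspan D S = {x. \<exists>f. (\<forall>s\<in>S. f s \<in> D) \<and> x = (\<Sum>s\<in>S. f s * s)}"

definition fg_ideal :: "('a::field) set \<Rightarrow> 'a set \<Rightarrow> bool" where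
  "fg_ideal D J \<longleftrightarrow> (\<exists>S. finite S \<and> J = dspan D S) \<and> J \<noteq> {0}"

definition ideal_mult :: "('a::field) set \<Rightarrow> 'a set \<Rightarrow> 'a set" where
  "ideal_mult I J = {x. \<exists>(n::nat) f g. (\<forall>i<n. f i \<in> I \<and> g i \<in> J) \<and> x = (\<Sum>i<n. f i * g i)}"

definition ideal_add :: "('a::field) set \<Rightarrow> 'a set \<Rightarrow> 'a set" where
  "ideal_add I J = {x. \<exists>a\<in>I. \<exists>b\<in>J. x = a + b}"

definition ideal_prod_list :: "('a::field) set \<Rightarrow> 'a set list \<Rightarrow> 'a set" where
  "ideal_prod_list D Is = foldr ideal_mult Is D"

definition ideal_pow :: "('a::field) set \<Rightarrow> 'a set \<Rightarrow> nat \<Rightarrow> 'a set" where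
  "ideal_pow D J n = ideal_prod_list D (replicate n J)"

definition star_operation :: "('a::field) set \<Rightarrow> ('a set \<Rightarrow> 'a set) \<Rightarrow> bool" where
  "star_operation D st \<longleftrightarrow>
     (\<forall>I. frac_ideal D I \<longrightarrow> frac_ideal D (st I)) \<and>
     (\<forall>x. x \<noteq> 0 \<longrightarrow> st (principal x D) = principal x D) \<and>
     (\<forall>x I. x \<noteq> 0 \<longrightarrow> frac_ideal D I \<longrightarrow> st ((\<lambda>y. x * y) ` I) = (\<lambda>y. x * y) ` st I) \<and>
     (\<forall>I. frac_ideal D I \<longrightarrow> I \<subseteq> st I) \<and>
     (\<forall>I J. frac_ideal D I \<longrightarrow> frac_ideal D J \<longrightarrow> I \<subseteq> J \<longrightarrow> st I \<subseteq> st J) \<and>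
     (\<forall>I. frac_ideal D I \<longrightarrow> st (st I) = st I)"

definition finite_character :: "('a::field) set \<Rightarrow> ('a set \<Rightarrow> 'a set) \<Rightarrow> bool" where
  "finite_character D st \<longleftrightarrow>
     (\<forall>I. frac_ideal D I \<longrightarrow> st I = \<Union>{st J | J. fg_ideal D J \<and> J \<subseteq> I})"

definition star_ideal :: "('a::field) set \<Rightarrow> ('a set \<Rightarrow> 'a set) \<Rightarrow> 'a set \<Rightarrow> bool" where
  "star_ideal D st I \<longleftrightarrow> frac_ideal D I \<and> st I = I"

definition finite_type :: "('a::field) set \<Rightarrow> ('a set \<Rightarrow> 'a set) \<Rightarrow> 'a set \<Rightarrow> bool" where
  "finite_type D st I \<longleftrightarrow> (\<exists>J. fg_ideal D J \<and> I = st J)"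

definition integral_star_ideal :: "('a::field) set \<Rightarrow> ('a set \<Rightarrow> 'a set) \<Rightarrow> 'a set \<Rightarrow> bool" where
  "integral_star_ideal D st I \<longleftrightarrow> star_ideal D st I \<and> I \<subseteq> D"

definition max_star_ideal :: "('a::field) set \<Rightarrow> ('a set \<Rightarrow> 'a set) \<Rightarrow> 'a set \<Rightarrow> bool" where
  "max_star_ideal D st P \<longleftrightarrow> integral_star_ideal D st P \<and> P \<noteq> D \<and>
     (\<forall>Q. integral_star_ideal D st Q \<and> Q \<noteq> D \<and> P \<subseteq> Q \<longrightarrow> Q = P)"

definition star_homog :: "('a::field) set \<Rightarrow> ('a set \<Rightarrow> 'a set) \<Rightarrow> 'a set \<Rightarrow> bool" where
  "star_homog D st I \<longleftrightarrow> integral_star_ideal D st I \<and> I \<noteq> D \<and> finite_type D st I \<and>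
     (\<forall>A B. integral_star_ideal D st A \<and> A \<noteq> D \<and> finite_type D st A \<and> I \<subseteq> A \<and>
            integral_star_ideal D st B \<and> B \<noteq> D \<and> finite_type D st B \<and> I \<subseteq> B
        \<longrightarrow> st (ideal_add A B) \<noteq> D)"

definition star_af_homog :: "('a::field) set \<Rightarrow> ('a set \<Rightarrow> 'a set) \<Rightarrow> 'a set \<Rightarrow> bool" where
  "star_af_homog D st I \<longleftrightarrow> star_homog D st I \<and>
     (\<forall>J. star_ideal D st J \<and> finite_type D st J \<and> I \<subseteq> J \<longrightarrow>
        (\<exists>n\<ge>1. \<exists>x. st (ideal_pow D J n) = principal x D))"

definition localization :: "('a::field) set \<Rightarrow> 'a set \<Rightarrow> 'a set" where
  "localization D P = {a / s | a s. a \<in> D \<and> s \<in> D - P}"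

definition valuation_domain :: "('a::field) set \<Rightarrow> bool" where
  "valuation_domain V \<longleftrightarrow> (\<forall>x. x \<noteq> 0 \<longrightarrow> x \<in> V \<or> inverse x \<in> V)"

definition prime_ideal :: "('a::field) set \<Rightarrow> 'a set \<Rightarrow> bool" where
  "prime_ideal D Q \<longleftrightarrow> submodule D Q \<and> Q \<subseteq> D \<and> Q \<noteq> D \<and>
     (\<forall>a\<in>D. \<forall>b\<in>D. a * b \<in> Q \<longrightarrow> a \<in> Q \<or> b \<in> Q)"

definition star_IRKT :: "('a::field) set \<Rightarrow> ('a set \<Rightarrow> 'a set) \<Rightarrow> bool" where
  "star_IRKT D st \<longleftrightarrow>
     (\<forall>P. max_star_ideal D st P \<longrightarrow> valuation_domain (localization D P)) \<and>
     D = (\<Inter>{localization D P | P. max_star_ideal D st P}) \<and>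
     (\<forall>x\<in>D. x \<noteq> 0 \<longrightarrow> finite {P. max_star_ideal D st P \<and> x \<in> P}) \<and>
     (\<forall>P1 P2 Q. max_star_ideal D st P1 \<and> max_star_ideal D st P2 \<and> P1 \<noteq> P2 \<and>
        prime_ideal D Q \<and> Q \<noteq> {0} \<longrightarrow> \<not> (Q \<subseteq> P1 \<and> Q \<subseteq> P2))"

definition almost_GCD :: "('a::field) set \<Rightarrow> bool" where
  "almost_GCD D \<longleftrightarrow> (\<forall>a\<in>D. \<forall>b\<in>D. a \<noteq> 0 \<and> b \<noteq> 0 \<longrightarrow>
     (\<exists>n\<ge>1. \<exists>c\<in>D. principal (a ^ n) D \<inter> principal (b ^ n) D = principal c D))"

end

theory Submission
  imports Defs
begin

text \<open>Since \<open>\<ast>\<close> has finite character, everything can be tested in the localizations \<open>D\<^sub>P\<close> at the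
  maximal \<open>\<ast>\<close>-ideals: \<open>I\<^sup>\<ast> = xD\<close> holds iff \<open>x\<close> generates \<open>I D\<^sub>P\<close> for every \<open>P\<close>.

  If \<open>I\<close> is \<open>\<ast>\<close>-af-homog and \<open>c \<in> D\<close>, then \<open>(I + cD)\<^sup>\<ast>\<close> is \<open>\<ast>\<close>-invertible and hence locally
  principal, so the local generator of \<open>I\<close> is comparable with every \<open>c\<close>.  Comparable elements are
  closed under products, so factorizations make every \<open>D\<^sub>P\<close> a valuation domain.  A \<open>\<ast>\<close>-homog ideal lies
  in exactly one maximal \<open>\<ast>\<close>-ideal, which gives local finiteness and independence.  Some power of
  each nonzero element is locally a product of elements lying in at most one maximal \<open>\<ast>\<close>-ideal; selecting
  factors of \<open>a\<^sup>n\<close> and \<open>b\<^sup>n\<close> place by place yields an element that is locally their gcd.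

  Conversely, the almost GCD property, applied locally in the valuation domains \<open>D\<^sub>P\<close>, makes a power
  of every finite type \<open>\<ast>\<close>-ideal principal.  For each of the finitely many \<open>P\<close> containing \<open>x\<close>,
  independence provides elements of \<open>x D\<^sub>P \<inter> D\<close> outside the other ones; together with \<open>x\<close> they
  generate a \<open>\<ast>\<close>-homog ideal equal to \<open>x D\<^sub>P\<close> at \<open>P\<close> and trivial elsewhere.\<close>

section \<open>Submodules, spans, products of ideals and unions of chains\<close>

lemma submodule_sum:
  assumes "submodule D I" "\<And>i. i \<in> A \<Longrightarrow> f i \<in> I"
  shows "sum f A \<in> I"
proof (cases "finite A")
  case True
  then show ?thesis using assms(2)
    by (induction A) (use assms(1) in \<open>auto simp: submodule_def\<close>)
next
  case False
  then show ?thesis using assms(1) by (auto simp: submodule_def)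
qed

lemma dspan_subset:
  assumes "submodule D I" "S \<subseteq> I"
  shows "dspan D S \<subseteq> I"
proof
  fix x assume "x \<in> dspan D S"
  then obtain f where f: "\<forall>s\<in>S. f s \<in> D" "x = (\<Sum>s\<in>S. f s * s)"
    by (auto simp: dspan_def)
  show "x \<in> I" unfolding f(2)
    using assms f(1) by (intro submodule_sum[OF assms(1)]) (auto simp: submodule_def)
qed

lemma ideal_multI: "a \<in> I \<Longrightarrow> b \<in> J \<Longrightarrow> a * b \<in> ideal_mult I J"
  unfolding ideal_mult_def
  by (rule CollectI, rule exI[of _ 1], rule exI[of _ "\<lambda>_. a"], rule exI[of _ "\<lambda>_. b"]) auto

lemma ideal_mult_subset:
  assumes "submodule D M" "\<And>a b. a \<in> I \<Longrightarrow> b \<in> J \<Longrightarrow> a * b \<in> M"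
  shows "ideal_mult I J \<subseteq> M"
proof
  fix x assume "x \<in> ideal_mult I J"
  then obtain n f g where "\<forall>i<n. f i \<in> I \<and> g i \<in> J" "x = (\<Sum>i<(n::nat). f i * g i)"
    by (auto simp: ideal_mult_def)
  then show "x \<in> M" using assms by (auto intro!: submodule_sum[OF assms(1)])
qed

lemma submodule_ideal_mult:
  assumes "submodule D I"
  shows "submodule D (ideal_mult I J)"
proof -
  have 0: "0 \<in> ideal_mult I J" unfolding ideal_mult_def
    by (rule CollectI, rule exI[of _ 0]) auto
  have a: "x + y \<in> ideal_mult I J" if xy: "x \<in> ideal_mult I J" "y \<in> ideal_mult I J" for x y
  proof -
    obtain n f g where 1: "\<forall>i<n. f i \<in> I \<and> g i \<in> J" "x = (\<Sum>i<(n::nat). f i * g i)"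
      using xy(1) by (auto simp: ideal_mult_def)
    obtain m f' g' where 2: "\<forall>i<m. f' i \<in> I \<and> g' i \<in> J" "y = (\<Sum>i<(m::nat). f' i * g' i)"
      using xy(2) by (auto simp: ideal_mult_def)
    \<comment> \<open>The two sums are concatenated: the first \<open>n\<close> terms come from
      \<open>x\<close>, the next \<open>m\<close> from \<open>y\<close>.\<close>
    define F where "F = (\<lambda>i. if i < n then f i else f' (i - n))"
    define G where "G = (\<lambda>i. if i < n then g i else g' (i - n))"
    have mem: "\<forall>i<n+m. F i \<in> I \<and> G i \<in> J" using 1(1) 2(1) by (auto simp: F_def G_def)
    have "(\<Sum>i<n+m. F i * G i) = (\<Sum>i<n. F i * G i) + (\<Sum>i<m. F (n + i) * G (n + i))"
      by (induction m) (auto simp: add.assoc)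
    also have "\<dots> = x + y" unfolding 1(2) 2(2) by (auto simp: F_def G_def)
    finally have eq: "x + y = (\<Sum>i<n+m. F i * G i)" by simp
    show ?thesis unfolding ideal_mult_def
      by (rule CollectI, rule exI[of _ "n + m"], rule exI[of _ F], rule exI[of _ G])
        (use mem eq in blast)
  qed
  have m: "d * x \<in> ideal_mult I J" if d: "d \<in> D" and x: "x \<in> ideal_mult I J" for d x
  proof -
    obtain n f g where 1: "\<forall>i<n. f i \<in> I \<and> g i \<in> J" "x = (\<Sum>i<(n::nat). f i * g i)"
      using x by (auto simp: ideal_mult_def)
    have eq: "d * x = (\<Sum>i<n. (d * f i) * g i)" by (simp add: 1(2) sum_distrib_left mult.assoc)
    have mem: "\<forall>i<n. d * f i \<in> I \<and> g i \<in> J" using 1(1) assms d by (auto simp: submodule_def)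
    show ?thesis unfolding ideal_mult_def
      by (rule CollectI, rule exI[of _ n], rule exI[of _ "\<lambda>i. d * f i"], rule exI[of _ g])
        (use mem eq in blast)
  qed
  show ?thesis unfolding submodule_def using 0 a m by blast
qed

lemma submodule_Union_chain:
  assumes "C \<noteq> {}" "\<And>I. I \<in> C \<Longrightarrow> submodule D I"
    and chain: "\<And>I J. I \<in> C \<Longrightarrow> J \<in> C \<Longrightarrow> I \<subseteq> J \<or> J \<subseteq> I"
  shows "submodule D (\<Union>C)"
  unfolding submodule_def
proof (intro conjI ballI)
  show "0 \<in> \<Union>C" using assms(1,2) by (auto simp: submodule_def)
next
  fix x y assume "x \<in> \<Union>C" "y \<in> \<Union>C"
  then obtain I J where IJ: "I \<in> C" "x \<in> I" "J \<in> C" "y \<in> J" by auto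
  then obtain K where "K \<in> C" "x \<in> K" "y \<in> K" using chain[of I J] by blast
  then show "x + y \<in> \<Union>C" using assms(2)[of K] by (auto simp: submodule_def)
next
  fix d x assume "d \<in> D" "x \<in> \<Union>C"
  then show "d * x \<in> \<Union>C" using assms(2) unfolding submodule_def by (metis Union_iff)
qed

text \<open>Of two members of the chain the larger contains what both contain, so induction on the
  finite set works. Together with finite character it shows that a union of a chain of star-ideals
  is star-closed.\<close>

lemma finite_subset_Union_chain:
  assumes "finite S" "S \<subseteq> \<Union>C" "C \<noteq> {}"
    and chain: "\<And>I J. I \<in> C \<Longrightarrow> J \<in> C \<Longrightarrow> I \<subseteq> J \<or> J \<subseteq> I"
  shows "\<exists>I\<in>C. S \<subseteq> I"
  using assms(1,2)
proof (induction S)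
  case empty
  then show ?case using assms(3) by auto
next
  case (insert s S)
  then obtain I J where "I \<in> C" "S \<subseteq> I" "J \<in> C" "s \<in> J" by auto
  then show ?case using chain[of I J] by blast
qed

section \<open>Fractional ideals and primes of a domain inside its quotient field\<close>

locale quotient_domain =
  fixes D :: "'a::field set"
  assumes dom: "is_domain_with_qf D"
begin

lemma D_closed [simp]:
  "0 \<in> D" "1 \<in> D" "a \<in> D \<Longrightarrow> b \<in> D \<Longrightarrow> a + b \<in> D" "a \<in> D \<Longrightarrow> b \<in> D \<Longrightarrow> a - b \<in> D"
  "a \<in> D \<Longrightarrow> b \<in> D \<Longrightarrow> a * b \<in> D"
  using dom by (auto simp: is_domain_with_qf_def)

lemma D_power [simp]: "a \<in> D \<Longrightarrow> a ^ n \<in> D"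
  by (induction n) auto

lemma denominator:
  obtains b where "b \<in> D" "b \<noteq> 0" "b * z \<in> D"
proof -
  obtain a b where "a \<in> D" "b \<in> D" "b \<noteq> 0" "z = a / b"
    using dom unfolding is_domain_with_qf_def by metis
  then show ?thesis using that[of b] by simp
qed

lemma submodule_D [simp]: "submodule D D"
  by (auto simp: submodule_def)

lemma common_denominator:
  assumes "finite S"
  shows "\<exists>d\<in>D. d \<noteq> 0 \<and> (\<forall>s\<in>S. d * s \<in> D)"
  using assms
proof (induction S)
  case empty
  then show ?case by (auto intro: bexI[of _ 1])
next
  case (insert s S)
  then obtain d where d: "d \<in> D" "d \<noteq> 0" "\<forall>s\<in>S. d * s \<in> D" by auto
  obtain b where b: "b \<in> D" "b \<noteq> 0" "b * s \<in> D" by (rule denominator)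
  have "d * b * t \<in> D" if "t \<in> insert s S" for t
  proof (cases "t = s")
    case True
    have "d * b * t = d * (b * s)" using True by simp
    then show ?thesis using d b by (metis D_closed(5))
  next
    case False
    have "d * b * t = b * (d * t)" by simp
    then show ?thesis using d b False that by (metis D_closed(5) insertE)
  qed
  then show ?case using d b by (intro bexI[of _ "d * b"]) auto
qed

lemma submodule_dspan: "submodule D (dspan D S)"
  unfolding submodule_def
proof (intro conjI ballI)
  show "0 \<in> dspan D S" unfolding dspan_def by (intro CollectI exI[of _ "\<lambda>_. 0"]) auto
next
  fix x y assume "x \<in> dspan D S" "y \<in> dspan D S"
  then obtain f g where "\<forall>s\<in>S. f s \<in> D" "x = (\<Sum>s\<in>S. f s * s)"
    "\<forall>s\<in>S. g s \<in> D" "y = (\<Sum>s\<in>S. g s * s)" by (auto simp: dspan_def)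
  then show "x + y \<in> dspan D S" unfolding dspan_def
    by (intro CollectI exI[of _ "\<lambda>s. f s + g s"]) (auto simp: distrib_right sum.distrib)
next
  fix d x assume "d \<in> D" "x \<in> dspan D S"
  then obtain f where "\<forall>s\<in>S. f s \<in> D" "x = (\<Sum>s\<in>S. f s * s)" by (auto simp: dspan_def)
  then show "d * x \<in> dspan D S" unfolding dspan_def using \<open>d \<in> D\<close>
    by (intro CollectI exI[of _ "\<lambda>s. d * f s"]) (auto simp: mult.assoc sum_distrib_left)
qed

lemma subset_dspan:
  assumes "finite S"
  shows "S \<subseteq> dspan D S"
proof
  fix s assume s: "s \<in> S"
  have "(\<Sum>t\<in>S. (if t = s then 1 else 0) * t) = (\<Sum>t\<in>S. if t = s then s else 0)"
    by (rule sum.cong) auto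
  also have "\<dots> = s" using assms s by simp
  finally show "s \<in> dspan D S" unfolding dspan_def
    by (intro CollectI exI[of _ "\<lambda>t. if t = s then 1 else 0"]) auto
qed

text \<open>Lets a condition of the form \<open>x * z \<in> I\<close>, checked on generators or on
  single products, pass to a whole span or product by way of \<open>dspan_subset\<close> and
  \<open>ideal_mult_subset\<close>.\<close>

lemma submodule_scaled: "submodule D I \<Longrightarrow> submodule D {z. x * z \<in> I}"
  by (auto simp: submodule_def distrib_left mult.left_commute)

lemma submodule_frac_ideal: "frac_ideal D I \<Longrightarrow> submodule D I"
  by (simp add: frac_ideal_def)

lemma frac_ideal_nonzero:
  assumes "frac_ideal D I"
  obtains x where "x \<in> I" "x \<noteq> 0"
  using assms by (auto simp: frac_ideal_def submodule_def)

lemma frac_ideal_denominator: "frac_ideal D I \<Longrightarrow> \<exists>d\<in>D. d \<noteq> 0 \<and> (\<forall>x\<in>I. d * x \<in> D)"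
  by (simp add: frac_ideal_def)

lemma frac_ideal_fg:
  assumes "fg_ideal D J"
  shows "frac_ideal D J"
proof -
  obtain S where S: "finite S" "J = dspan D S" "J \<noteq> {0}" using assms by (auto simp: fg_ideal_def)
  obtain d where d: "d \<in> D" "d \<noteq> 0" "\<forall>s\<in>S. d * s \<in> D" using common_denominator[OF S(1)] by auto
  have "dspan D S \<subseteq> {z. d * z \<in> D}"
    using d by (intro dspan_subset[OF submodule_scaled[OF submodule_D]]) auto
  then show ?thesis unfolding frac_ideal_def using S d submodule_dspan[of S] by auto
qed

lemma fg_ideal_dspan:
  assumes "finite S" "s \<in> S" "s \<noteq> 0"
  shows "fg_ideal D (dspan D S)"
  unfolding fg_ideal_def using assms subset_dspan[OF assms(1)] by auto

lemma frac_ideal_integral: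
  assumes "submodule D I" "I \<subseteq> D" "x \<in> I" "x \<noteq> 0"
  shows "frac_ideal D I"
  unfolding frac_ideal_def using assms by (auto intro!: bexI[of _ 1])

lemma mem_principal: "x \<noteq> 0 \<Longrightarrow> z \<in> principal x D \<longleftrightarrow> z / x \<in> D"
  by (force simp: principal_def image_iff)

lemma principal_1: "principal 1 D = D"
  by (simp add: principal_def)

lemma frac_ideal_mult:
  assumes "frac_ideal D I" "frac_ideal D J"
  shows "frac_ideal D (ideal_mult I J)"
proof -
  obtain a where a: "a \<in> I" "a \<noteq> 0" using assms(1) by (rule frac_ideal_nonzero)
  obtain b where b: "b \<in> J" "b \<noteq> 0" using assms(2) by (rule frac_ideal_nonzero)
  obtain d where d: "d \<in> D" "d \<noteq> 0" "\<And>x. x \<in> I \<Longrightarrow> d * x \<in> D"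
    using frac_ideal_denominator[OF assms(1)] by metis
  obtain e where e: "e \<in> D" "e \<noteq> 0" "\<And>x. x \<in> J \<Longrightarrow> e * x \<in> D"
    using frac_ideal_denominator[OF assms(2)] by metis
  have "ideal_mult I J \<subseteq> {z. d * e * z \<in> D}"
  proof (rule ideal_mult_subset[OF submodule_scaled[OF submodule_D]])
    fix a b assume "a \<in> I" "b \<in> J"
    then have "(d * a) * (e * b) \<in> D" by (intro D_closed d(3) e(3))
    moreover have "(d * a) * (e * b) = d * e * (a * b)" by (simp only: mult_ac)
    ultimately show "a * b \<in> {z. d * e * z \<in> D}" by simp
  qed
  moreover have "ideal_mult I J \<noteq> {0}"
  proof
    assume "ideal_mult I J = {0}"
    then have "a * b = 0" using ideal_multI[OF a(1) b(1)] by blast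
    then show False using a b by simp
  qed
  moreover have "d * e \<in> D" "d * e \<noteq> 0" using d e by auto
  moreover have "submodule D (ideal_mult I J)"
    using submodule_frac_ideal[OF assms(1)] by (rule submodule_ideal_mult)
  ultimately show ?thesis unfolding frac_ideal_def by (intro conjI bexI[of _ "d * e"]) auto
qed

lemma frac_ideal_D: "frac_ideal D D"
  by (rule frac_ideal_integral[of _ 1]) auto

lemma frac_ideal_prod_list:
  assumes "\<And>I. I \<in> set Is \<Longrightarrow> frac_ideal D I"
  shows "frac_ideal D (ideal_prod_list D Is)"
  using assms by (induction Is) (auto simp: ideal_prod_list_def frac_ideal_D frac_ideal_mult)

lemma ideal_prod_list_Cons:
  "ideal_prod_list D (I # Is) = ideal_mult I (ideal_prod_list D Is)"
  by (simp add: ideal_prod_list_def)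

lemma ideal_prod_list_subset:
  assumes "\<And>I. I \<in> set Is \<Longrightarrow> I \<subseteq> D"
  shows "ideal_prod_list D Is \<subseteq> D"
  using assms
proof (induction Is)
  case (Cons J Js)
  have "J \<subseteq> D" "ideal_prod_list D Js \<subseteq> D" using Cons by auto
  then show ?case unfolding ideal_prod_list_Cons
    by (intro ideal_mult_subset[OF submodule_D]) (simp add: subset_iff)
qed (simp add: ideal_prod_list_def)

text \<open>The empty product is \<open>D\<close>, which no prime contains. Otherwise an element of
  the first factor outside \<open>P\<close> forces the product of the remaining factors into
  \<open>P\<close>.\<close>

lemma prime_contains_factor:
  assumes "prime_ideal D P" "\<And>I. I \<in> set Is \<Longrightarrow> I \<subseteq> D" "ideal_prod_list D Is \<subseteq> P"
  shows "\<exists>I\<in>set Is. I \<subseteq> P"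
  using assms(2,3)
proof (induction Is)
  case Nil
  then show ?case using assms(1) by (auto simp: ideal_prod_list_def prime_ideal_def)
next
  case (Cons I Is)
  have sub: "ideal_prod_list D Is \<subseteq> D" using Cons.prems(1) by (intro ideal_prod_list_subset) simp
  show ?case
  proof (cases "I \<subseteq> P")
    case False
    then obtain i where i: "i \<in> I" "i \<notin> P" by auto
    have "j \<in> P" if j: "j \<in> ideal_prod_list D Is" for j
    proof -
      have "i * j \<in> P" using ideal_multI[OF i(1) j] Cons.prems(2) by (auto simp: ideal_prod_list_Cons)
      moreover have "i \<in> D" "j \<in> D" using i j sub Cons.prems(1)[of I] by auto
      ultimately show ?thesis using assms(1) i unfolding prime_ideal_def by blast
    qed
    then show ?thesis using Cons by auto
  qed auto
qed

text \<open>Krull's argument: by Zorn's lemma there is an ideal maximal among those that contain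
  \<open>I\<close> and miss \<open>S\<close>, and such an ideal is prime.\<close>

lemma prime_disjoint_multiplicative:
  assumes S: "1 \<in> S" "\<And>a b. a \<in> S \<Longrightarrow> b \<in> S \<Longrightarrow> a * b \<in> S"
    and I: "submodule D I" "I \<subseteq> D" "I \<inter> S = {}"
  obtains Q where "prime_ideal D Q" "I \<subseteq> Q" "Q \<inter> S = {}"
proof -
  define A where "A = {Q. submodule D Q \<and> Q \<subseteq> D \<and> I \<subseteq> Q \<and> Q \<inter> S = {}}"
  have "\<exists>Q\<in>A. \<forall>X\<in>A. Q \<subseteq> X \<longrightarrow> X = Q"
  proof (rule subset_Zorn_nonempty)
    show "A \<noteq> {}" using I by (auto simp: A_def)
  next
    fix C assume C: "C \<noteq> {}" "subset.chain A C"
    then have CA: "C \<subseteq> A" and ch: "\<And>X Y. X \<in> C \<Longrightarrow> Y \<in> C \<Longrightarrow> X \<subseteq> Y \<or> Y \<subseteq> X"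
      by (auto simp: subset_chain_def)
    have "submodule D (\<Union>C)" using C(1) CA ch by (intro submodule_Union_chain) (auto simp: A_def)
    then show "\<Union>C \<in> A" using C(1) CA unfolding A_def by blast
  qed
  then obtain Q where Q: "Q \<in> A" and mx: "\<And>X. X \<in> A \<Longrightarrow> Q \<subseteq> X \<Longrightarrow> X = Q" by blast
  have Qs: "submodule D Q" "Q \<subseteq> D" "I \<subseteq> Q" "Q \<inter> S = {}" using Q by (auto simp: A_def)
  have smult: "d * q \<in> Q" if "d \<in> D" "q \<in> Q" for d q using Qs(1) that by (auto simp: submodule_def)
  \<comment> \<open>By maximality of \<open>Q\<close>, the strictly larger ideal
    \<open>Q + aD\<close> has to meet \<open>S\<close>.\<close>
  have ext: "\<exists>q\<in>Q. \<exists>d\<in>D. q + d * a \<in> S" if a: "a \<in> D" "a \<notin> Q" for a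
  proof (rule ccontr)
    assume n: "\<not> ?thesis"
    define X where "X = {q + d * a | q d. q \<in> Q \<and> d \<in> D}"
    have "submodule D X" unfolding submodule_def
    proof (intro conjI ballI)
      show "0 \<in> X" unfolding X_def using Qs(1)
        by (intro CollectI exI[of _ 0]) (auto simp: submodule_def)
    next
      fix x y assume "x \<in> X" "y \<in> X"
      then obtain q d q' d' where "q \<in> Q" "d \<in> D" "q' \<in> Q" "d' \<in> D" "x = q + d * a" "y = q' + d' * a"
        by (auto simp: X_def)
      moreover from this have "x + y = (q + q') + (d + d') * a" by (simp add: algebra_simps)
      moreover have "q + q' \<in> Q" "d + d' \<in> D" using Qs(1) calculation by (auto simp: submodule_def)
      ultimately show "x + y \<in> X" unfolding X_def by blast
    next
      fix e x assume e: "e \<in> D" "x \<in> X"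
      then obtain q d where "q \<in> Q" "d \<in> D" "x = q + d * a"
        by (auto simp: X_def)
      moreover from this have "e * x = (e * q) + (e * d) * a" by (simp add: algebra_simps)
      moreover have "e * q \<in> Q" "e * d \<in> D" using smult e calculation by auto
      ultimately show "e * x \<in> X" unfolding X_def by blast
    qed
    moreover have "X \<subseteq> D" using Qs a by (auto simp: X_def)
    moreover have QX: "Q \<subseteq> X" 
    proof
      fix q assume "q \<in> Q"
      then show "q \<in> X" unfolding X_def by (intro CollectI exI[of _ q] exI[of _ 0]) auto
    qed
    moreover have "X \<inter> S = {}" using n by (auto simp: X_def)
    ultimately have "X = Q" using mx Qs(3) by (auto simp: A_def)
    moreover have "a \<in> X" unfolding X_def using Qs(1)
      by (intro CollectI exI[of _ 0] exI[of _ 1]) (auto simp: submodule_def)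
    ultimately show False using a by auto
  qed
  have "prime_ideal D Q" unfolding prime_ideal_def
  proof (intro conjI ballI impI)
    fix a b assume ab: "a \<in> D" "b \<in> D" "a * b \<in> Q"
    show "a \<in> Q \<or> b \<in> Q"
    proof (rule ccontr)
      assume "\<not> ?thesis"
      then obtain q d r e where *: "q \<in> Q" "d \<in> D" "q + d * a \<in> S" "r \<in> Q" "e \<in> D" "r + e * b \<in> S"
        using ext ab by metis
      \<comment> \<open>Each summand has one of \<open>q\<close>, \<open>r\<close> and
        \<open>a * b\<close> as a factor, all in \<open>Q\<close>, so a product of two elements of
        \<open>S\<close> falls into \<open>Q\<close>.\<close>
      have "(q + d * a) * (r + e * b) = (r + e * b) * q + (d * a) * r + (d * e) * (a * b)"
        by (simp add: algebra_simps)
      moreover have "\<dots> \<in> Q"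
      proof -
        have "(r + e * b) * q \<in> Q" "(d * a) * r \<in> Q" "(d * e) * (a * b) \<in> Q"
          by (rule smult; use * ab Qs(2) in \<open>simp add: subset_iff\<close>)+
        then show ?thesis using Qs(1) by (simp add: submodule_def)
      qed
      ultimately show False using S(2) * Qs(4) by (metis IntI empty_iff)
    qed
  qed (use Qs S(1) in auto)
  then show ?thesis using that Qs by blast
qed

lemma submodule_divided:
  assumes "submodule D M"
  shows "submodule D {z. z / x \<in> M}"
proof -
  \<comment> \<open>For \<open>x = 0\<close> both conditions read \<open>0 \<in> M\<close>, by the
    conventions on division by zero.\<close>
  have "{z. z / x \<in> M} = {z. inverse x * z \<in> M}" by (simp add: field_simps)
  then show ?thesis using submodule_scaled[OF assms] by simp
qed

lemma frac_ideal_scaled: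
  assumes "frac_ideal D I" "x \<noteq> 0"
  shows "frac_ideal D ((\<lambda>y. x * y) ` I)"
proof -
  have sub: "submodule D I" using assms(1) by (rule submodule_frac_ideal)
  have "submodule D ((\<lambda>y. x * y) ` I)"
    unfolding submodule_def
  proof (intro conjI ballI)
    show "0 \<in> (\<lambda>y. x * y) ` I" using sub by (force simp: submodule_def)
  next
    fix y z assume "y \<in> (\<lambda>y. x * y) ` I" "z \<in> (\<lambda>y. x * y) ` I"
    then obtain i j where ij: "i \<in> I" "j \<in> I" "y = x * i" "z = x * j" by blast
    then have "i + j \<in> I" "y + z = x * (i + j)" using sub by (auto simp: submodule_def distrib_left)
    then show "y + z \<in> (\<lambda>y. x * y) ` I" by blast
  next
    fix d y assume "d \<in> D" "y \<in> (\<lambda>y. x * y) ` I"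
    then obtain i where i: "i \<in> I" "y = x * i" by blast
    then have "d * i \<in> I" "d * y = x * (d * i)" using sub \<open>d \<in> D\<close> by (auto simp: submodule_def)
    then show "d * y \<in> (\<lambda>y. x * y) ` I" by blast
  qed
  moreover obtain i where i: "i \<in> I" "i \<noteq> 0" using assms(1) by (rule frac_ideal_nonzero)
  have "x * i \<in> (\<lambda>y. x * y) ` I" "x * i \<noteq> 0" using i assms(2) by auto
  then have "(\<lambda>y. x * y) ` I \<noteq> {0}" by blast
  moreover obtain d where d: "d \<in> D" "d \<noteq> 0" "\<And>i. i \<in> I \<Longrightarrow> d * i \<in> D"
    using frac_ideal_denominator[OF assms(1)] by metis
  obtain b where b: "b \<in> D" "b \<noteq> 0" "b * x \<in> D" by (rule denominator)
  have "(d * b) * (x * i) \<in> D" if "i \<in> I" for i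
  proof -
    have "(b * x) * (d * i) \<in> D" using that b d by simp
    moreover have "(b * x) * (d * i) = (d * b) * (x * i)" by (simp only: mult_ac)
    ultimately show ?thesis by simp
  qed
  then have "\<forall>y\<in>(\<lambda>y. x * y) ` I. d * b * y \<in> D" by blast
  moreover have "d * b \<in> D" "d * b \<noteq> 0" using d b by auto
  ultimately show ?thesis unfolding frac_ideal_def by blast
qed

section \<open>Localizations and local generators\<close>

abbreviation "loc \<equiv> localization D"

text \<open>\<open>x\<close> and \<open>y\<close> differ by a unit of the localization, that is,
  they generate the same fractional ideal of it.\<close>

definition assoc_at :: "'a set \<Rightarrow> 'a \<Rightarrow> 'a \<Rightarrow> bool" where
  "assoc_at P x y \<longleftrightarrow> x \<noteq> 0 \<and> y \<noteq> 0 \<and> x / y \<in> loc P \<and> y / x \<in> loc P"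

text \<open>The extension of \<open>I\<close> to the localization at \<open>P\<close> is generated by \<open>g\<close>.\<close>

definition generates_at :: "'a set \<Rightarrow> 'a set \<Rightarrow> 'a \<Rightarrow> bool" where
  "generates_at P I g \<longleftrightarrow>
     g \<noteq> 0 \<and> (\<forall>i\<in>I. i / g \<in> loc P) \<and> (\<exists>i\<in>I. i \<noteq> 0 \<and> g / i \<in> loc P)"

context
  fixes P :: "'a set"
  assumes prime: "prime_ideal D P"
begin

lemma prime_facts:
  "submodule D P" "P \<subseteq> D" "0 \<in> P" "1 \<notin> P"
  "a \<in> D \<Longrightarrow> b \<in> D \<Longrightarrow> a * b \<in> P \<Longrightarrow> a \<in> P \<or> b \<in> P"
  "a \<in> D \<Longrightarrow> b \<in> P \<Longrightarrow> a * b \<in> P"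
proof -
  show "1 \<notin> P"
  proof
    assume 1: "1 \<in> P"
    have "d \<in> P" if "d \<in> D" for d
    proof -
      have "d * 1 \<in> P" using prime 1 that unfolding prime_ideal_def submodule_def by blast
      then show ?thesis by simp
    qed
    then show False using prime by (auto simp: prime_ideal_def)
  qed
qed (use prime in \<open>auto simp: prime_ideal_def submodule_def\<close>)

text \<open>Replaces fractions by denominators outside \<open>P\<close>. Sums and products in the
  localization are then cleared by the product of two denominators, which stays outside
  \<open>P\<close> by primality.\<close>

lemma mem_loc: "z \<in> loc P \<longleftrightarrow> (\<exists>s\<in>D. s \<notin> P \<and> s * z \<in> D)"
proof
  assume "z \<in> loc P"
  then obtain a s where as: "z = a / s" "a \<in> D" "s \<in> D" "s \<notin> P" by (auto simp: localization_def)
  then have "s \<noteq> 0" using prime_facts(3) by auto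
  then show "\<exists>s\<in>D. s \<notin> P \<and> s * z \<in> D" using as by (intro bexI[of _ s]) auto
next
  assume "\<exists>s\<in>D. s \<notin> P \<and> s * z \<in> D"
  then obtain s where s: "s \<in> D" "s \<notin> P" "s * z \<in> D" by blast
  then have "s \<noteq> 0" using prime_facts(3) by auto
  then show "z \<in> loc P" unfolding localization_def using s
    by (intro CollectI exI[of _ "s * z"] exI[of _ s]) auto
qed

lemma loc_base: "z \<in> D \<Longrightarrow> z \<in> loc P"
  unfolding mem_loc using prime_facts(4) by (intro bexI[of _ 1]) auto

lemma loc_mult:
  assumes "x \<in> loc P" "y \<in> loc P"
  shows "x * y \<in> loc P"
proof -
  obtain s where s: "s \<in> D" "s \<notin> P" "s * x \<in> D" using assms(1) mem_loc by blast
  obtain t where t: "t \<in> D" "t \<notin> P" "t * y \<in> D" using assms(2) mem_loc by blast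
  have "(s * x) * (t * y) \<in> D" using s t by simp
  moreover have "(s * x) * (t * y) = (s * t) * (x * y)" by (simp only: mult_ac)
  moreover have "s * t \<notin> P" using s t prime_facts(5) by blast
  ultimately show ?thesis unfolding mem_loc using s t by (intro bexI[of _ "s * t"]) auto
qed

lemma loc_add:
  assumes "x \<in> loc P" "y \<in> loc P"
  shows "x + y \<in> loc P"
proof -
  obtain s where s: "s \<in> D" "s \<notin> P" "s * x \<in> D" using assms(1) mem_loc by blast
  obtain t where t: "t \<in> D" "t \<notin> P" "t * y \<in> D" using assms(2) mem_loc by blast
  have "t * (s * x) + s * (t * y) \<in> D" using s t by simp
  moreover have "t * (s * x) + s * (t * y) = (s * t) * (x + y)" by (simp add: algebra_simps)
  moreover have "s * t \<notin> P" using s t prime_facts(5) by blast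
  ultimately show ?thesis unfolding mem_loc using s t by (intro bexI[of _ "s * t"]) auto
qed

lemma submodule_loc: "submodule D (loc P)"
  unfolding submodule_def using loc_base loc_add loc_mult by simp

lemma loc_inverse: "s \<in> D \<Longrightarrow> s \<notin> P \<Longrightarrow> inverse s \<in> loc P"
  unfolding mem_loc using prime_facts(3) by (intro bexI[of _ s]) (cases "s = 0"; simp)+

text \<open>A denominator \<open>s\<close> clearing the inverse of \<open>p\<close> equals
  \<open>(s / p) * p\<close>, a multiple of \<open>p\<close> in \<open>D\<close>, and so lies in
  \<open>P\<close> after all.\<close>

lemma loc_inverse_prime:
  assumes "p \<in> P" "p \<noteq> 0"
  shows "inverse p \<notin> loc P"
proof
  assume "inverse p \<in> loc P"
  then obtain s where s: "s \<in> D" "s \<notin> P" "s * inverse p \<in> D" using mem_loc by blast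
  have "(s * inverse p) * p \<in> P" using prime_facts(6)[OF s(3) assms(1)] .
  then show False using s assms by (simp add: mult.assoc)
qed

text \<open>Transitivity of divisibility in the localization, where \<open>x / y \<in> loc P\<close>
  is read as: \<open>y\<close> divides \<open>x\<close>.\<close>

lemma loc_div_trans:
  assumes "x / y \<in> loc P" "y / z \<in> loc P" "y \<noteq> 0"
  shows "x / z \<in> loc P"
  using loc_mult[OF assms(1,2)] assms(3) by simp

lemma assoc_at_refl: "x \<noteq> 0 \<Longrightarrow> assoc_at P x x"
  unfolding assoc_at_def using loc_base by simp

lemma assoc_at_trans: "assoc_at P x y \<Longrightarrow> assoc_at P y z \<Longrightarrow> assoc_at P x z"
  unfolding assoc_at_def using loc_div_trans by blast

lemma assoc_at_mult:
  assumes "assoc_at P x y" "assoc_at P x' y'"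
  shows "assoc_at P (x * x') (y * y')"
proof -
  have "(x * x') / (y * y') = (x / y) * (x' / y')" "(y * y') / (x * x') = (y / x) * (y' / x')" by simp_all
  then show ?thesis using assms loc_mult unfolding assoc_at_def by (metis mult_eq_0_iff)
qed

lemma assoc_at_power: "assoc_at P x y \<Longrightarrow> assoc_at P (x ^ n) (y ^ n)"
  by (induction n) (auto intro: assoc_at_mult assoc_at_refl)

lemma assoc_at_unit: "y \<in> D \<Longrightarrow> y \<notin> P \<Longrightarrow> assoc_at P y 1"
  unfolding assoc_at_def using loc_base loc_inverse prime_facts(3)
  by (auto simp: divide_inverse)

lemma generates_at_unique:
  assumes "generates_at P I g" "generates_at P I h"
  shows "assoc_at P g h"
  using assms loc_div_trans unfolding generates_at_def assoc_at_def by blast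

lemma generates_at_assoc:
  assumes "generates_at P I g" "assoc_at P g h"
  shows "generates_at P I h"
  using assms loc_div_trans unfolding generates_at_def assoc_at_def by blast

lemma generates_at_D: "generates_at P D 1"
  unfolding generates_at_def using loc_base by (auto intro!: bexI[of _ 1])

lemma generates_at_mult:
  assumes "generates_at P I g" "generates_at P J h"
  shows "generates_at P (ideal_mult I J) (g * h)"
proof -
  have gh: "g \<noteq> 0" "h \<noteq> 0" using assms by (auto simp: generates_at_def)
  have "ideal_mult I J \<subseteq> {z. z / (g * h) \<in> loc P}"
  proof (rule ideal_mult_subset[OF submodule_divided[OF submodule_loc]])
    fix a b assume "a \<in> I" "b \<in> J"
    then have "(a / g) * (b / h) \<in> loc P" using assms loc_mult unfolding generates_at_def by blast
    then show "a * b \<in> {z. z / (g * h) \<in> loc P}" by simp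
  qed
  moreover obtain i where i: "i \<in> I" "i \<noteq> 0" "g / i \<in> loc P" using assms(1) unfolding generates_at_def by blast
  obtain j where j: "j \<in> J" "j \<noteq> 0" "h / j \<in> loc P" using assms(2) unfolding generates_at_def by blast
  have "(g * h) / (i * j) \<in> loc P" using loc_mult[OF i(3) j(3)] by simp
  moreover have "i * j \<in> ideal_mult I J" "i * j \<noteq> 0" using ideal_multI i j by auto
  ultimately show ?thesis unfolding generates_at_def using gh by (intro conjI bexI[of _ "i * j"]) auto
qed

lemma generates_at_pow: "generates_at P I g \<Longrightarrow> generates_at P (ideal_pow D I n) (g ^ n)"
  by (induction n)
    (simp_all add: ideal_pow_def ideal_prod_list_def generates_at_D generates_at_mult)

end

end

section \<open>Star operations of finite character\<close>

locale star_domain = quotient_domain D for D :: "'a::field set" +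
  fixes st :: "'a set \<Rightarrow> 'a set"
  assumes star: "star_operation D st" and fin_char: "finite_character D st"
begin

lemma st_frac: "frac_ideal D I \<Longrightarrow> frac_ideal D (st I)"
  and st_principal: "x \<noteq> 0 \<Longrightarrow> st (principal x D) = principal x D"
  and st_scale: "x \<noteq> 0 \<Longrightarrow> frac_ideal D I \<Longrightarrow> st ((\<lambda>y. x * y) ` I) = (\<lambda>y. x * y) ` st I"
  and st_extensive: "frac_ideal D I \<Longrightarrow> I \<subseteq> st I"
  and st_mono: "frac_ideal D I \<Longrightarrow> frac_ideal D J \<Longrightarrow> I \<subseteq> J \<Longrightarrow> st I \<subseteq> st J"
  and st_idem: "frac_ideal D I \<Longrightarrow> st (st I) = st I"
  using star by (simp_all add: star_operation_def)

lemma st_D: "st D = D"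
  using st_principal[of 1] by (simp add: principal_1)

lemma st_subset:
  assumes "frac_ideal D I" "frac_ideal D M" "st M = M" "I \<subseteq> M"
  shows "st I \<subseteq> M"
  using st_mono[OF assms(1,2,4)] assms(3) by simp

text \<open>Scaling commutes with the star operation and \<open>M\<close> is star-closed, so it
  suffices to test the elements of \<open>I\<close>. Typically \<open>1 \<in> st I\<close> is then
  used to get \<open>x \<in> M\<close>.\<close>

lemma st_scaled_mem:
  assumes "frac_ideal D I" "frac_ideal D M" "st M = M" "x \<noteq> 0"
    and "\<And>i. i \<in> I \<Longrightarrow> x * i \<in> M" "i \<in> st I"
  shows "x * i \<in> M"
proof -
  have "st ((\<lambda>y. x * y) ` I) \<subseteq> M"
    using assms frac_ideal_scaled by (intro st_subset) auto
  then show ?thesis using st_scale[OF assms(4,1)] assms(6) by blast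
qed

section \<open>Maximal star-ideals and the local-global principle\<close>

lemma max_facts:
  assumes "max_star_ideal D st P"
  shows "frac_ideal D P" "st P = P" "P \<subseteq> D" "P \<noteq> D"
  using assms by (auto simp: max_star_ideal_def integral_star_ideal_def star_ideal_def)

lemma integral_star_st:
  assumes "frac_ideal D I" "I \<subseteq> D"
  shows "integral_star_ideal D st (st I)"
  unfolding integral_star_ideal_def star_ideal_def
  using st_frac[OF assms(1)] st_idem[OF assms(1)] st_subset[OF assms(1) frac_ideal_D st_D assms(2)]
  by blast

lemma submodule_one:
  assumes "submodule D I" "1 \<in> I"
  shows "D \<subseteq> I"
proof
  fix d assume "d \<in> D"
  then have "d * 1 \<in> I" using assms unfolding submodule_def by blast
  then show "d \<in> I" by simp
qed

lemma max_one:
  assumes "max_star_ideal D st P"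
  shows "1 \<notin> P"
  using max_facts[OF assms] submodule_one[OF submodule_frac_ideal] by blast

lemma submodule_ideal_add:
  assumes "submodule D I" "submodule D J"
  shows "submodule D (ideal_add I J)"
  unfolding submodule_def
proof (intro conjI ballI)
  show "0 \<in> ideal_add I J" using assms unfolding ideal_add_def submodule_def
    by (intro CollectI bexI[of _ 0]) auto
next
  fix x y assume "x \<in> ideal_add I J" "y \<in> ideal_add I J"
  then obtain a b c d where *: "a \<in> I" "b \<in> J" "x = a + b" "c \<in> I" "d \<in> J" "y = c + d"
    unfolding ideal_add_def by blast
  then have "x + y = (a + c) + (b + d)" "a + c \<in> I" "b + d \<in> J"
    using assms by (auto simp: submodule_def)
  then show "x + y \<in> ideal_add I J" unfolding ideal_add_def by blast
next
  fix e x assume "e \<in> D" "x \<in> ideal_add I J"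
  then obtain a b where *: "a \<in> I" "b \<in> J" "x = a + b"
    unfolding ideal_add_def by blast
  then have "e * x = e * a + e * b" "e * a \<in> I" "e * b \<in> J"
    using assms \<open>e \<in> D\<close> by (auto simp: submodule_def distrib_left)
  then show "e * x \<in> ideal_add I J" unfolding ideal_add_def by blast
qed

lemma ideal_add_upper:
  assumes "submodule D I" "submodule D J"
  shows "I \<subseteq> ideal_add I J" "J \<subseteq> ideal_add I J"
proof -
  have 0: "0 \<in> I" "0 \<in> J" using assms by (auto simp: submodule_def)
  show "I \<subseteq> ideal_add I J"
  proof
    fix i assume "i \<in> I"
    then show "i \<in> ideal_add I J" unfolding ideal_add_def using 0
      by (intro CollectI bexI[of _ i] bexI[of _ 0]) auto
  qed
  show "J \<subseteq> ideal_add I J"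
  proof
    fix i assume "i \<in> J"
    then show "i \<in> ideal_add I J" unfolding ideal_add_def using 0
      by (intro CollectI bexI[of _ 0] bexI[of _ i]) auto
  qed
qed

lemma ideal_add_least:
  assumes "submodule D M" "I \<subseteq> M" "J \<subseteq> M"
  shows "ideal_add I J \<subseteq> M"
  using assms by (auto simp: ideal_add_def submodule_def subset_iff)

lemma frac_ideal_add_integral:
  assumes "frac_ideal D I" "submodule D J" "I \<subseteq> D" "J \<subseteq> D"
  shows "frac_ideal D (ideal_add I J)"
proof -
  have s: "submodule D I" using assms(1) by (rule submodule_frac_ideal)
  obtain i where i: "i \<in> I" "i \<noteq> 0" using assms(1) by (rule frac_ideal_nonzero)
  show ?thesis
  proof (rule frac_ideal_integral)
    show "submodule D (ideal_add I J)" using s assms(2) by (rule submodule_ideal_add)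
    show "ideal_add I J \<subseteq> D" using assms by (intro ideal_add_least[OF submodule_D])
    show "i \<in> ideal_add I J" using ideal_add_upper[OF s assms(2)] i by blast
  qed (rule i(2))
qed

lemma submodule_principal: "submodule D (principal x D)"
proof (cases "x = 0")
  case True
  moreover have "D \<noteq> {}" using D_closed(1) by blast
  ultimately have "principal x D = {0}" by (simp add: principal_def image_constant_conv)
  then show ?thesis by (simp add: submodule_def)
next
  case False
  have "principal x D = {z. z / x \<in> D}" using mem_principal[OF False] by auto
  then show ?thesis using submodule_divided[OF submodule_D] by simp
qed

text \<open>The star closure of \<open>P + J\<close> is an integral star-ideal above
  \<open>P\<close>. If it were proper, maximality would make it \<open>P\<close>, and
  \<open>J\<close> would lie in \<open>P\<close>.\<close>

lemma max_comaximal: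
  assumes P: "max_star_ideal D st P" and J: "submodule D J" "J \<subseteq> D" "\<not> J \<subseteq> P"
  shows "st (ideal_add P J) = D"
proof (rule ccontr)
  assume n: "st (ideal_add P J) \<noteq> D"
  have sP: "submodule D P" using max_facts(1)[OF P] by (rule submodule_frac_ideal)
  have fr: "frac_ideal D (ideal_add P J)" using max_facts[OF P] J by (intro frac_ideal_add_integral)
  have "integral_star_ideal D st (st (ideal_add P J))"
    using max_facts[OF P] J by (intro integral_star_st[OF fr] ideal_add_least[OF submodule_D])
  moreover have "ideal_add P J \<subseteq> st (ideal_add P J)" by (rule st_extensive[OF fr])
  ultimately have "st (ideal_add P J) = P"
    using P n ideal_add_upper[OF sP J(1)] unfolding max_star_ideal_def by blast
  then show False using J(3) ideal_add_upper[OF sP J(1)] st_extensive[OF fr] by blast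
qed

text \<open>If \<open>a\<close> is outside \<open>P\<close>, then \<open>P + aD\<close> has star
  closure \<open>D\<close>. For \<open>a * b \<in> P\<close>, multiplication by \<open>b\<close>
  sends \<open>P + aD\<close> into \<open>P\<close>, hence also its closure, and in particular
  1.\<close>

lemma max_prime:
  assumes P: "max_star_ideal D st P"
  shows "prime_ideal D P"
  unfolding prime_ideal_def
proof (intro conjI ballI impI)
  have sP: "submodule D P" using max_facts(1)[OF P] by (rule submodule_frac_ideal)
  then show "submodule D P" .
  show "P \<subseteq> D" "P \<noteq> D" using max_facts[OF P] by auto
  fix a b assume ab: "a \<in> D" "b \<in> D" "a * b \<in> P"
  show "a \<in> P \<or> b \<in> P"
  proof (rule ccontr)
    assume n: "\<not> ?thesis"
    then have b0: "b \<noteq> 0" using sP by (auto simp: submodule_def)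
    have "principal a D \<subseteq> D" using ab by (auto simp: principal_def)
    moreover have "a \<in> principal a D" unfolding principal_def by (intro image_eqI[of _ _ 1]) auto
    ultimately have c: "st (ideal_add P (principal a D)) = D"
      using n by (intro max_comaximal[OF P submodule_principal]) auto
    have "b * 1 \<in> P"
    proof (rule st_scaled_mem[OF _ max_facts(1,2)[OF P] b0])
      show "frac_ideal D (ideal_add P (principal a D))"
        using max_facts[OF P] \<open>principal a D \<subseteq> D\<close>
        by (intro frac_ideal_add_integral submodule_principal)
      show "1 \<in> st (ideal_add P (principal a D))" using c by simp
      fix i assume "i \<in> ideal_add P (principal a D)"
      then obtain p d where "p \<in> P" "d \<in> D" "i = p + a * d" by (auto simp: ideal_add_def principal_def)
      moreover from this have "b * p \<in> P" "d * (a * b) \<in> P"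
        using sP ab by (auto simp: submodule_def)
      ultimately have "b * i = b * p + d * (a * b)" "b * p \<in> P" "d * (a * b) \<in> P"
        by (simp_all add: algebra_simps)
      then show "b * i \<in> P" using sP by (auto simp: submodule_def)
    qed
    then show False using n by simp
  qed
qed

text \<open>Finite character in working form: finitely many elements of \<open>I\<close> already
  account for a given element of the closure.\<close>

lemma st_fg_subset:
  assumes "frac_ideal D I" "x \<in> st I"
  obtains S where "finite S" "S \<subseteq> I" "dspan D S \<noteq> {0}" "x \<in> st (dspan D S)"
proof -
  have "x \<in> \<Union>{st J | J. fg_ideal D J \<and> J \<subseteq> I}"
    using fin_char assms unfolding finite_character_def by blast
  then obtain J where J: "fg_ideal D J" "J \<subseteq> I" "x \<in> st J" by blast
  then obtain S where S: "finite S" "J = dspan D S" "J \<noteq> {0}" unfolding fg_ideal_def by blast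
  then show ?thesis using that[of S] J subset_dspan[OF S(1)] by blast
qed

text \<open>Zorn's lemma. The union of a chain is star-closed, because an element of its closure
  comes from finitely many elements, and these lie in a single member of the chain.\<close>

lemma exists_max_star_ideal:
  assumes "integral_star_ideal D st I" "I \<noteq> D"
  obtains P where "max_star_ideal D st P" "I \<subseteq> P"
proof -
  define A where "A = {Q. integral_star_ideal D st Q \<and> Q \<noteq> D \<and> I \<subseteq> Q}"
  have "\<exists>Q\<in>A. \<forall>X\<in>A. Q \<subseteq> X \<longrightarrow> X = Q"
  proof (rule subset_Zorn_nonempty)
    show "A \<noteq> {}" using assms by (auto simp: A_def)
  next
    fix C assume C: "C \<noteq> {}" "subset.chain A C"
    then have CA: "C \<subseteq> A" and ch: "\<And>X Y. X \<in> C \<Longrightarrow> Y \<in> C \<Longrightarrow> X \<subseteq> Y \<or> Y \<subseteq> X"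
      by (auto simp: subset_chain_def)
    have mem: "frac_ideal D X" "st X = X" "X \<subseteq> D" "X \<noteq> D" "I \<subseteq> X" if "X \<in> C" for X
      using CA that by (auto simp: A_def integral_star_ideal_def star_ideal_def)
    have sub: "submodule D (\<Union>C)" using C(1) ch mem(1)
      by (intro submodule_Union_chain submodule_frac_ideal) auto
    obtain X where X: "X \<in> C" using C(1) by blast
    obtain i where i: "i \<in> X" "i \<noteq> 0" using mem(1)[OF X] by (rule frac_ideal_nonzero)
    have UD: "\<Union>C \<subseteq> D" using mem(3) by blast
    have fr: "frac_ideal D (\<Union>C)" by (rule frac_ideal_integral[OF sub UD, of i]) (use i X in auto)
    have "st (\<Union>C) \<subseteq> \<Union>C"
    proof
      fix x assume "x \<in> st (\<Union>C)"
      then obtain S where S: "finite S" "S \<subseteq> \<Union>C" "dspan D S \<noteq> {0}" "x \<in> st (dspan D S)"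
        using st_fg_subset[OF fr] by metis
      obtain Y where Y: "Y \<in> C" "S \<subseteq> Y"
        using finite_subset_Union_chain[OF S(1,2) C(1) ch] by blast
      have "st (dspan D S) \<subseteq> Y"
        by (rule st_subset[OF frac_ideal_fg mem(1,2)[OF Y(1)] dspan_subset[OF submodule_frac_ideal[OF mem(1)[OF Y(1)]] Y(2)]])
          (use S in \<open>auto simp: fg_ideal_def\<close>)
      then show "x \<in> \<Union>C" using S(4) Y(1) by blast
    qed
    then have "st (\<Union>C) = \<Union>C" using st_extensive[OF fr] by blast
    \<comment> \<open>Properness passes to the union because it amounts to the absence of 1.\<close>
    moreover have "1 \<notin> X" if X: "X \<in> C" for X
      using mem(3,4)[OF X] submodule_one[OF submodule_frac_ideal[OF mem(1)[OF X]]] by blast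
    then have "\<Union>C \<noteq> D" using D_closed(2) by blast
    moreover have "I \<subseteq> \<Union>C" using mem(5)[OF X] X by blast
    ultimately show "\<Union>C \<in> A" unfolding A_def integral_star_ideal_def star_ideal_def
      using fr UD by simp
  qed
  then obtain Q where Q: "Q \<in> A" and mx: "\<And>X. X \<in> A \<Longrightarrow> Q \<subseteq> X \<Longrightarrow> X = Q" by blast
  have "max_star_ideal D st Q" "I \<subseteq> Q" unfolding max_star_ideal_def
    using Q mx unfolding A_def by blast+
  then show ?thesis using that by blast
qed

lemma st_eq_D:
  assumes "frac_ideal D I" "I \<subseteq> D" "\<And>P. max_star_ideal D st P \<Longrightarrow> \<not> I \<subseteq> P"
  shows "st I = D"
proof (rule ccontr)
  assume "st I \<noteq> D"
  then obtain P where "max_star_ideal D st P" "st I \<subseteq> P"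
    using exists_max_star_ideal[OF integral_star_st[OF assms(1,2)]] by blast
  then show False using assms(3) st_extensive[OF assms(1)] by blast
qed

text \<open>If \<open>z\<close> is not in \<open>D\<close>, the ideal \<open>I\<close> of its
  denominators in \<open>D\<close> cannot have closure \<open>D\<close>, so it lies in some maximal
  star-ideal \<open>P\<close>. But a denominator witnessing \<open>z \<in> loc P\<close> lies in
  \<open>I\<close> and outside \<open>P\<close>.\<close>

lemma mem_D_local:
  assumes "\<And>P. max_star_ideal D st P \<Longrightarrow> z \<in> loc P"
  shows "z \<in> D"
proof (rule ccontr)
  assume z: "z \<notin> D"
  then have z0: "z \<noteq> 0" by auto
  define I where "I = D \<inter> {d. z * d \<in> D}"
  have sub: "submodule D I" using submodule_scaled[OF submodule_D, of z]
    unfolding I_def submodule_def by simp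
  obtain b where b: "b \<in> D" "b \<noteq> 0" "b * z \<in> D" by (rule denominator)
  have fr: "frac_ideal D I"
    by (rule frac_ideal_integral[OF sub, of b]) (use b in \<open>auto simp: I_def mult.commute\<close>)
  have "st I \<noteq> D"
  proof
    assume "st I = D"
    then have "z * 1 \<in> D"
      using st_scaled_mem[OF fr frac_ideal_D st_D z0, of 1] by (auto simp: I_def)
    then show False using z by simp
  qed
  then obtain P where P: "max_star_ideal D st P" "I \<subseteq> P" using st_eq_D[OF fr] I_def by blast
  then obtain s where "s \<in> D" "s \<notin> P" "s * z \<in> D"
    using assms mem_loc[OF max_prime] by blast
  then show False using P(2) by (auto simp: I_def mult.commute)
qed

text \<open>Local-global principle. After division by \<open>x\<close> the question is whether an
  integral ideal has star closure \<open>D\<close>, and this is decided by whether some maximal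
  star-ideal contains it.\<close>

lemma st_principal_iff:
  assumes I: "frac_ideal D I" and x: "x \<noteq> 0"
  shows "st I = principal x D \<longleftrightarrow> (\<forall>P. max_star_ideal D st P \<longrightarrow> generates_at P I x)"
proof (intro iffI allI impI)
  fix P assume eq: "st I = principal x D" and P: "max_star_ideal D st P"
  note pr = max_prime[OF P]
  have D: "i / x \<in> D" if "i \<in> I" for i
    using st_extensive[OF I] that eq mem_principal[OF x] by blast
  \<comment> \<open>Otherwise division by \<open>x\<close> would send \<open>I\<close>, hence
    \<open>st I\<close>, into \<open>P\<close>; but \<open>x\<close> itself is in
    \<open>st I\<close> and goes to 1.\<close>
  have "\<exists>i\<in>I. inverse x * i \<notin> P"
  proof (rule ccontr)
    assume "\<not> ?thesis"
    moreover have "x \<in> st I" using eq mem_principal[OF x] x by simp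
    ultimately have "inverse x * x \<in> P"
      using x by (intro st_scaled_mem[OF I max_facts(1,2)[OF P], of "inverse x" x]) auto
    then show False using max_one[OF P] x by simp
  qed
  then obtain i where i: "i \<in> I" "i / x \<notin> P" by (auto simp: field_simps)
  then have "inverse (i / x) \<in> loc P" using loc_inverse[OF pr] D by blast
  then show "generates_at P I x" unfolding generates_at_def
    using x i D loc_base[OF pr] prime_facts(3)[OF pr] by (intro conjI bexI[of _ i]) auto
next
  assume gen: "\<forall>P. max_star_ideal D st P \<longrightarrow> generates_at P I x"
  have D: "i / x \<in> D" if "i \<in> I" for i
    using gen that by (intro mem_D_local) (auto simp: generates_at_def)
  have x': "inverse x \<noteq> 0" using x by simp
  have "st ((\<lambda>y. inverse x * y) ` I) = D"
  proof (rule st_eq_D)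
    show "frac_ideal D ((\<lambda>y. inverse x * y) ` I)" by (rule frac_ideal_scaled[OF I x'])
    show "(\<lambda>y. inverse x * y) ` I \<subseteq> D" using D by (auto simp: field_simps)
    fix P assume P: "max_star_ideal D st P"
    then obtain i where i: "i \<in> I" "i \<noteq> 0" "x / i \<in> loc P" using gen unfolding generates_at_def by blast
    have "i / x \<notin> P" using loc_inverse_prime[OF max_prime[OF P], of "i / x"] i x by auto
    then show "\<not> (\<lambda>y. inverse x * y) ` I \<subseteq> P" using i by (auto simp: field_simps)
  qed
  then have eq: "(\<lambda>y. inverse x * y) ` st I = D" using st_scale[OF x' I] by simp
  have "st I = (\<lambda>y. x * y) ` (\<lambda>y. inverse x * y) ` st I" 
    using x by (simp add: image_image mult.assoc[symmetric])
  then show "st I = principal x D" unfolding eq principal_def .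
qed

section \<open>From factorizations to almost GCD domains\<close>

lemma star_ideal_fg:
  assumes "frac_ideal D J" "st J = J" "finite_type D st J"
  obtains S where "finite S" "fg_ideal D (dspan D S)" "J = st (dspan D S)"
  using assms unfolding finite_type_def fg_ideal_def by blast

lemma principal_nonzero:
  assumes "frac_ideal D I" "st I = principal x D"
  shows "x \<noteq> 0"
proof
  assume "x = 0"
  then have "st I \<subseteq> {0}" using assms(2) by (auto simp: principal_def)
  then show False using frac_ideal_nonzero[OF st_frac[OF assms(1)]] by blast
qed

lemma frac_ideal_pow: "frac_ideal D J \<Longrightarrow> frac_ideal D (ideal_pow D J n)"
  unfolding ideal_pow_def by (rule frac_ideal_prod_list) simp

text \<open>\<open>y\<inverse> F F\<^bsup>n-1\<^esup>\<close> is not contained in \<open>P\<close>, so some \<open>h\<close> in \<open>y\<inverse> F\<^bsup>n-1\<^esup>\<close> maps \<open>F\<close> into \<open>D\<close> and some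
  generator \<open>g\<close> outside \<open>P\<close>; then every \<open>i \<in> F\<close> is \<open>g \<cdot> (h i) / (h g)\<close>.\<close>

lemma power_principal_generates:
  assumes S: "finite S" "fg_ideal D (dspan D S)" and F: "F = st (dspan D S)"
    and n: "n \<ge> 1" and eq: "st (ideal_pow D F n) = principal y D"
    and P: "max_star_ideal D st P"
  shows "\<exists>g\<in>S. generates_at P F g"
proof -
  note pr = max_prime[OF P]
  have fS: "frac_ideal D (dspan D S)" using S(2) by (rule frac_ideal_fg)
  have fF: "frac_ideal D F" unfolding F by (rule st_frac[OF fS])
  obtain m where m: "n = Suc m" using n by (cases n) auto
  define K where "K = ideal_pow D F m"
  have pow: "ideal_pow D F n = ideal_mult F K"
    by (simp add: m K_def ideal_pow_def ideal_prod_list_Cons)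
  have fFK: "frac_ideal D (ideal_mult F K)"
    unfolding K_def by (intro frac_ideal_mult fF frac_ideal_pow)
  have y: "y \<noteq> 0" using principal_nonzero[OF fFK] eq pow by simp
  have "generates_at P (ideal_mult F K) y"
    using st_principal_iff[OF fFK y] eq pow P by simp
  then obtain z where z: "z \<in> ideal_mult F K" "z \<noteq> 0" "y / z \<in> loc P"
    unfolding generates_at_def by blast
  have "z / y \<notin> P" using loc_inverse_prime[OF pr, of "z / y"] z y by auto
  then have "\<not> ideal_mult F K \<subseteq> {z. z / y \<in> P}" using z(1) by blast
  then obtain f h where fh: "f \<in> F" "h \<in> K" "f * h / y \<notin> P"
    using ideal_mult_subset[OF submodule_divided[OF prime_facts(1)[OF pr]]] by blast
  define x where "x = h / y"
  have xf: "x * f \<notin> P" using fh(3) by (simp add: x_def mult.commute)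
  have x0: "x \<noteq> 0" using xf prime_facts(3)[OF pr] by auto
  have xD: "x * i \<in> D" if "i \<in> F" for i
  proof -
    have "i * h \<in> principal y D"
      using st_extensive[OF fFK] ideal_multI[OF that fh(2)] eq pow by auto
    then show ?thesis using mem_principal[OF y] by (simp add: x_def mult.commute)
  qed
  \<comment> \<open>If \<open>x\<close> sent all generators into \<open>P\<close>, it would send the
    closure \<open>F\<close> there too, including \<open>f\<close>.\<close>
  have "\<exists>g\<in>S. x * g \<notin> P"
  proof (rule ccontr)
    assume "\<not> ?thesis"
    then have "dspan D S \<subseteq> {z. x * z \<in> P}"
      by (intro dspan_subset[OF submodule_scaled[OF prime_facts(1)[OF pr]]]) auto
    then have "x * f \<in> P"
      by (intro st_scaled_mem[OF fS max_facts(1,2)[OF P] x0, of f]) (use fh(1) F in auto)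
    then show False using xf by simp
  qed
  then obtain g where g: "g \<in> S" "x * g \<notin> P" by blast
  have g0: "g \<noteq> 0" using g prime_facts(3)[OF pr] by auto
  have gF: "g \<in> F" using g(1) subset_dspan[OF S(1)] st_extensive[OF fS] F by blast
  have inv: "inverse (x * g) \<in> loc P" using loc_inverse[OF pr xD[OF gF] g(2)] .
  have "i / g \<in> loc P" if "i \<in> F" for i
  proof -
    have "(x * i) * inverse (x * g) \<in> loc P" using loc_mult[OF pr loc_base[OF pr xD[OF that]] inv] .
    then show ?thesis using x0 by (simp add: field_simps)
  qed
  moreover have "g / g \<in> loc P" using g0 loc_base[OF pr] by simp
  ultimately have "generates_at P F g" unfolding generates_at_def using g0 gF by blast
  then show ?thesis using g(1) by blast
qed

text \<open>Letting \<open>c\<close> range over the whole localization, not only over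
  \<open>D\<close>, allows the quotient \<open>c / g\<close> to take the place of \<open>c\<close>
  when a product \<open>g * h\<close> is compared.\<close>

definition comparable_at :: "'a set \<Rightarrow> 'a \<Rightarrow> bool" where
  "comparable_at P g \<longleftrightarrow> g \<noteq> 0 \<and> g \<in> loc P \<and>
     (\<forall>c\<in>loc P. c \<noteq> 0 \<longrightarrow> g / c \<in> loc P \<or> c / g \<in> loc P)"

lemma af_homogD:
  assumes "star_af_homog D st I"
  shows "frac_ideal D I" "st I = I" "I \<subseteq> D" "finite_type D st I"
  using assms
  by (auto simp: star_af_homog_def star_homog_def integral_star_ideal_def star_ideal_def)

text \<open>Adjoining \<open>c\<close> to the generators of \<open>I\<close> gives an ideal
  \<open>J\<close> above \<open>I\<close> with a principal power, so one member of
  \<open>insert c S\<close> generates \<open>J\<close> at \<open>P\<close>. If it is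
  \<open>c\<close>, then \<open>c\<close> divides \<open>g\<close> locally; if it comes from
  \<open>S\<close>, it is a multiple of \<open>g\<close> and divides \<open>c\<close>.\<close>

lemma af_homog_generates:
  assumes I: "star_af_homog D st I" and P: "max_star_ideal D st P"
  shows "\<exists>g. generates_at P I g \<and> comparable_at P g"
proof -
  note pr = max_prime[OF P]
  obtain S where S: "finite S" "fg_ideal D (dspan D S)" "I = st (dspan D S)"
    using star_ideal_fg af_homogD(1,2,4)[OF I] by metis
  have "\<exists>n\<ge>1. \<exists>x. st (ideal_pow D I n) = principal x D"
    using I af_homogD[OF I] unfolding star_af_homog_def star_ideal_def by blast
  then obtain g where g: "g \<in> S" "generates_at P I g"
    using power_principal_generates[OF S _ _ P] by blast
  have fS: "frac_ideal D (dspan D S)" using S(2) by (rule frac_ideal_fg)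
  have SI: "S \<subseteq> I" using subset_dspan[OF S(1)] st_extensive[OF fS] S(3) by blast
  have g0: "g \<noteq> 0" using g(2) by (simp add: generates_at_def)
  have cmp: "g / c \<in> loc P \<or> c / g \<in> loc P" if c: "c \<in> D" "c \<noteq> 0" for c
  proof -
    define J where "J = st (dspan D (insert c S))"
    have fin: "finite (insert c S)" using S(1) by simp
    have fg: "fg_ideal D (dspan D (insert c S))" using fg_ideal_dspan[OF fin _ c(2)] by simp
    have fr: "frac_ideal D (dspan D (insert c S))" using fg by (rule frac_ideal_fg)
    have incl: "insert c S \<subseteq> J" using subset_dspan[OF fin] st_extensive[OF fr] J_def by blast
    have "dspan D S \<subseteq> dspan D (insert c S)"
      using subset_dspan[OF fin] by (intro dspan_subset[OF submodule_dspan]) auto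
    then have "I \<subseteq> J" unfolding S(3) J_def by (rule st_mono[OF fS fr])
    moreover have "star_ideal D st J" "finite_type D st J"
      using st_frac[OF fr] st_idem[OF fr] fg by (auto simp: star_ideal_def finite_type_def J_def)
    ultimately have "\<exists>n\<ge>1. \<exists>x. st (ideal_pow D J n) = principal x D"
      using I unfolding star_af_homog_def by blast
    then obtain g' where g': "g' \<in> insert c S" "generates_at P J g'"
      using power_principal_generates[OF fin fg J_def _ _ P] by blast
    show ?thesis
    proof (cases "g' = c")
      case True
      then show ?thesis using g' g(1) incl unfolding generates_at_def by blast
    next
      case False
      then have "g' / g \<in> loc P" using g' g(2) SI unfolding generates_at_def by blast
      moreover have "c / g' \<in> loc P" "g' \<noteq> 0" using g' incl unfolding generates_at_def by blast+
      ultimately show ?thesis using loc_div_trans[OF pr] by blast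
    qed
  qed
  have "comparable_at P g" unfolding comparable_at_def
  proof (intro conjI ballI impI)
    show "g \<noteq> 0" by (rule g0)
    show "g \<in> loc P" using g(1) SI af_homogD(3)[OF I] loc_base[OF pr] by blast
  next
    fix c assume c: "c \<in> loc P" "c \<noteq> 0"
    then obtain s where s: "s \<in> D" "s \<notin> P" "s * c \<in> D" using mem_loc[OF pr] by blast
    have s0: "s \<noteq> 0" using s prime_facts(3)[OF pr] by auto
    \<comment> \<open>\<open>s\<close> is a unit of the localization, so comparing \<open>g\<close>
      with \<open>s * c\<close>, which lies in \<open>D\<close>, also compares it with
      \<open>c\<close>.\<close>
    consider "g / (s * c) \<in> loc P" | "s * c / g \<in> loc P" using cmp[OF s(3)] s0 c by auto
    then show "g / c \<in> loc P \<or> c / g \<in> loc P"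
    proof cases
      case 1
      then have "s * (g / (s * c)) \<in> loc P" using loc_mult[OF pr loc_base[OF pr s(1)]] by blast
      then show ?thesis using s0 by simp
    next
      case 2
      then have "inverse s * (s * c / g) \<in> loc P" using loc_mult[OF pr loc_inverse[OF pr s(1,2)]] by blast
      then show ?thesis using s0 by (simp add: field_simps)
    qed
  qed
  then show ?thesis using g(2) by blast
qed

text \<open>If \<open>c\<close> divides \<open>g\<close>, it divides the product. If
  \<open>g\<close> divides \<open>c\<close>, the quotient \<open>c / g\<close> is again in the
  localization and is comparable with \<open>h\<close>.\<close>

lemma comparable_at_mult:
  assumes P: "prime_ideal D P" and g: "comparable_at P g" and h: "comparable_at P h"
  shows "comparable_at P (g * h)"
  unfolding comparable_at_def
proof (intro conjI ballI impI)
  show "g * h \<noteq> 0" "g * h \<in> loc P" using g h loc_mult[OF P] by (auto simp: comparable_at_def)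
  fix c assume c: "c \<in> loc P" "c \<noteq> 0"
  have g0: "g \<noteq> 0" using g by (simp add: comparable_at_def)
  consider "g / c \<in> loc P" | "c / g \<in> loc P" using g c unfolding comparable_at_def by blast
  then show "g * h / c \<in> loc P \<or> c / (g * h) \<in> loc P"
  proof cases
    case 1
    then have "g / c * h \<in> loc P" using h loc_mult[OF P] unfolding comparable_at_def by blast
    then show ?thesis by simp
  next
    case 2
    moreover have "c / g \<noteq> 0" using c g0 by simp
    ultimately have "h / (c / g) \<in> loc P \<or> c / g / h \<in> loc P" using h unfolding comparable_at_def by blast
    then show ?thesis by (simp add: mult.commute)
  qed
qed

lemma af_homog_prod_generates:
  assumes "\<And>I. I \<in> set Is \<Longrightarrow> star_af_homog D st I" and P: "max_star_ideal D st P"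
  shows "\<exists>g. generates_at P (ideal_prod_list D Is) g \<and> comparable_at P g"
  using assms(1)
proof (induction Is)
  case Nil
  have "1 / c \<in> loc P \<or> c / 1 \<in> loc P" if "c \<in> loc P" for c using that by simp
  then have "comparable_at P 1" using loc_base[OF max_prime[OF P]] by (simp add: comparable_at_def)
  then show ?case using generates_at_D[OF max_prime[OF P]] by (auto simp: ideal_prod_list_def)
next
  case (Cons I Is)
  obtain g where "generates_at P I g" "comparable_at P g" using af_homog_generates[OF Cons.prems P] by auto
  moreover obtain h where "generates_at P (ideal_prod_list D Is) h" "comparable_at P h" using Cons by auto
  ultimately show ?case unfolding ideal_prod_list_Cons
    using generates_at_mult[OF max_prime[OF P]] comparable_at_mult[OF max_prime[OF P]] by blast
qed

text \<open>For distinct \<open>P\<close> and \<open>Q\<close> the closure of \<open>P + Q\<close>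
  is \<open>D\<close>. By finite character finitely many sums \<open>p s + q s\<close> already have
  1 in their closure. Adjoining the \<open>p s\<close> and the \<open>q s\<close> separately to the
  generators of \<open>I\<close> gives proper finite type ideals \<open>A\<close> and
  \<open>B\<close> with \<open>(A + B)\<close> closing up to \<open>D\<close>.\<close>

lemma homog_unique_max:
  assumes I: "star_homog D st I" and P: "max_star_ideal D st P" "I \<subseteq> P"
    and Q: "max_star_ideal D st Q" "I \<subseteq> Q"
  shows "P = Q"
proof (rule ccontr)
  assume ne: "P \<noteq> Q"
  have sP: "submodule D P" using max_facts(1)[OF P(1)] by (rule submodule_frac_ideal)
  have sQ: "submodule D Q" using max_facts(1)[OF Q(1)] by (rule submodule_frac_ideal)
  have "\<not> Q \<subseteq> P"
    using ne P(1) Q(1) unfolding max_star_ideal_def by blast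
  then have PQ: "st (ideal_add P Q) = D"
    using max_comaximal[OF P(1) sQ] max_facts[OF Q(1)] by blast
  have fPQ: "frac_ideal D (ideal_add P Q)"
    using max_facts[OF P(1)] max_facts[OF Q(1)] sQ by (intro frac_ideal_add_integral)
  have "1 \<in> st (ideal_add P Q)" using PQ by simp
  then obtain S where S: "finite S" "S \<subseteq> ideal_add P Q" "dspan D S \<noteq> {0}" "1 \<in> st (dspan D S)"
    using st_fg_subset[OF fPQ] by metis
  have "\<forall>s\<in>S. \<exists>p q. p \<in> P \<and> q \<in> Q \<and> s = p + q" using S(2) unfolding ideal_add_def by blast
  then obtain p q where pq: "\<And>s. s \<in> S \<Longrightarrow> p s \<in> P \<and> q s \<in> Q \<and> s = p s + q s" by metis
  have Ist: "frac_ideal D I" "st I = I" "finite_type D st I"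
    using I by (auto simp: star_homog_def integral_star_ideal_def star_ideal_def)
  obtain T where T: "finite T" "fg_ideal D (dspan D T)" "I = st (dspan D T)"
    using star_ideal_fg[OF Ist] by metis
  have fT: "frac_ideal D (dspan D T)" using T(2) by (rule frac_ideal_fg)
  have TI: "T \<subseteq> I" using subset_dspan[OF T(1)] st_extensive[OF fT] T(3) by blast
  \<comment> \<open>Formulated for arbitrary \<open>M\<close> and \<open>r\<close> to serve both
    \<open>P\<close> with \<open>p\<close> and \<open>Q\<close> with \<open>q\<close>; the enlarged
    ideal is proper because it stays inside \<open>M\<close>.\<close>
  have enlarge: "integral_star_ideal D st (st (dspan D (T \<union> r ` S))) \<and> st (dspan D (T \<union> r ` S)) \<noteq> D \<and>
      finite_type D st (st (dspan D (T \<union> r ` S))) \<and> I \<subseteq> st (dspan D (T \<union> r ` S)) \<and>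
      r ` S \<subseteq> st (dspan D (T \<union> r ` S)) \<and> st (dspan D (T \<union> r ` S)) \<subseteq> M"
    if M: "max_star_ideal D st M" "I \<subseteq> M" and r: "r ` S \<subseteq> M" for M r
  proof -
    have fin: "finite (T \<union> r ` S)" using T(1) S(1) by simp
    have "\<exists>t\<in>T. t \<noteq> 0"
    proof (rule ccontr)
      assume "\<not> ?thesis"
      then have "dspan D T \<subseteq> {0}" by (intro dspan_subset) (auto simp: submodule_def)
      then show False using frac_ideal_nonzero[OF fT] by blast
    qed
    then have fg: "fg_ideal D (dspan D (T \<union> r ` S))" using fg_ideal_dspan[OF fin] by blast
    have fr: "frac_ideal D (dspan D (T \<union> r ` S))" using fg by (rule frac_ideal_fg)
    have sub: "dspan D (T \<union> r ` S) \<subseteq> M"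
      using TI M(2) r by (intro dspan_subset[OF submodule_frac_ideal[OF max_facts(1)[OF M(1)]]]) auto
    have le: "st (dspan D (T \<union> r ` S)) \<subseteq> M"
      by (rule st_subset[OF fr max_facts(1,2)[OF M(1)] sub])
    have "dspan D (T \<union> r ` S) \<subseteq> D" using sub max_facts(3)[OF M(1)] by blast
    then have 1: "integral_star_ideal D st (st (dspan D (T \<union> r ` S)))"
      by (rule integral_star_st[OF fr])
    have "dspan D T \<subseteq> dspan D (T \<union> r ` S)"
      using subset_dspan[OF fin] by (intro dspan_subset[OF submodule_dspan]) auto
    then have 2: "I \<subseteq> st (dspan D (T \<union> r ` S))" unfolding T(3) by (rule st_mono[OF fT fr])
    have 3: "r ` S \<subseteq> st (dspan D (T \<union> r ` S))" using subset_dspan[OF fin] st_extensive[OF fr] by blast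
    have 4: "st (dspan D (T \<union> r ` S)) \<noteq> D" using le max_facts(3,4)[OF M(1)] by blast
    have 5: "finite_type D st (st (dspan D (T \<union> r ` S)))" using fg by (auto simp: finite_type_def)
    show ?thesis using 1 2 3 4 5 le by blast
  qed
  define A where "A = st (dspan D (T \<union> p ` S))"
  define B where "B = st (dspan D (T \<union> q ` S))"
  have A: "integral_star_ideal D st A" "A \<noteq> D" "finite_type D st A" "I \<subseteq> A" "p ` S \<subseteq> A" "A \<subseteq> P"
    using enlarge[OF P, of p] pq unfolding A_def by blast+
  have B: "integral_star_ideal D st B" "B \<noteq> D" "finite_type D st B" "I \<subseteq> B" "q ` S \<subseteq> B" "B \<subseteq> Q"
    using enlarge[OF Q, of q] pq unfolding B_def by blast+
  have fA: "frac_ideal D A" "A \<subseteq> D" and fB: "frac_ideal D B" "B \<subseteq> D"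
    using A(1) B(1) by (auto simp: integral_star_ideal_def star_ideal_def)
  have fAB: "frac_ideal D (ideal_add A B)"
    using fA fB submodule_frac_ideal by (intro frac_ideal_add_integral)
  have "S \<subseteq> ideal_add A B"
  proof
    fix s assume "s \<in> S"
    then have "s = p s + q s" "p s \<in> A" "q s \<in> B" using pq A(5) B(5) by blast+
    then show "s \<in> ideal_add A B" unfolding ideal_add_def by blast
  qed
  then have "dspan D S \<subseteq> ideal_add A B"
    by (rule dspan_subset[OF submodule_frac_ideal[OF fAB]])
  moreover have "frac_ideal D (dspan D S)"
    using S(1,3) by (intro frac_ideal_fg) (auto simp: fg_ideal_def)
  ultimately have "1 \<in> st (ideal_add A B)" using st_mono[OF _ fAB] S(4) by blast
  then have "D \<subseteq> st (ideal_add A B)" by (rule submodule_one[OF submodule_frac_ideal[OF st_frac[OF fAB]]])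
  moreover have "st (ideal_add A B) \<subseteq> D"
    using fA fB by (intro st_subset[OF fAB frac_ideal_D st_D] ideal_add_least[OF submodule_D])
  ultimately show False using I A B unfolding star_homog_def by blast
qed

lemma af_homog_unique_max:
  assumes "star_af_homog D st I" "max_star_ideal D st P" "I \<subseteq> P" "max_star_ideal D st Q" "I \<subseteq> Q"
  shows "P = Q"
proof -
  have "star_homog D st I" using assms(1) by (simp add: star_af_homog_def)
  then show ?thesis using assms(2-5) by (rule homog_unique_max)
qed

text \<open>At each \<open>P\<close> one of \<open>A\<close> and \<open>B\<close> divides the other
  and \<open>c\<close> is associated with the multiple, so \<open>c\<close> is a local least common
  multiple. Membership in principal ideals of \<open>D\<close> can be tested locally.\<close>

lemma local_lcm:
  assumes "A \<noteq> 0" "B \<noteq> 0" "c \<noteq> 0"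
    and loc: "\<And>P. max_star_ideal D st P \<Longrightarrow>
      A / B \<in> loc P \<and> assoc_at P c A \<or> B / A \<in> loc P \<and> assoc_at P c B"
  shows "principal A D \<inter> principal B D = principal c D"
proof -
  have "z / A \<in> D \<and> z / B \<in> D \<longleftrightarrow> z / c \<in> D" for z
  proof
    assume z: "z / A \<in> D \<and> z / B \<in> D"
    show "z / c \<in> D"
    proof (rule mem_D_local)
      fix P assume P: "max_star_ideal D st P"
      then have "z / A \<in> loc P" "z / B \<in> loc P" using z loc_base[OF max_prime] by blast+
      then show "z / c \<in> loc P"
        using loc[OF P] loc_div_trans[OF max_prime[OF P]] unfolding assoc_at_def by blast
    qed
  next
    assume z: "z / c \<in> D"
    have "z / A \<in> loc P \<and> z / B \<in> loc P" if P: "max_star_ideal D st P" for P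
    proof -
      have "z / c \<in> loc P" using z loc_base[OF max_prime[OF P]] by blast
      then show ?thesis
        using loc[OF P] loc_div_trans[OF max_prime[OF P]] assms unfolding assoc_at_def by meson
    qed
    then show "z / A \<in> D \<and> z / B \<in> D" by (blast intro: mem_D_local)
  qed
  then show ?thesis using mem_principal assms(1-3) by blast
qed

section \<open>Powers as local products of elements lying in at most one maximal star-ideal\<close>

lemma loc_power: "prime_ideal D P \<Longrightarrow> x \<in> loc P \<Longrightarrow> x ^ n \<in> loc P"
  by (induction n) (auto simp: loc_base loc_mult)

lemma assoc_at_sym: "assoc_at P x y \<Longrightarrow> assoc_at P y x"
  by (simp add: assoc_at_def)

lemma assoc_at_divide:
  assumes "prime_ideal D P" "assoc_at P x y" "assoc_at P x' y'"
  shows "assoc_at P (x / x') (y / y')"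
proof -
  have "assoc_at P (inverse x') (inverse y')"
    using assms(3) by (auto simp: assoc_at_def divide_inverse mult.commute)
  then show ?thesis using assoc_at_mult[OF assms(1,2)] by (simp add: divide_inverse)
qed

text \<open>The discarded factors lie outside \<open>P\<close>, so they are units of the
  localization.\<close>

lemma assoc_at_prod_list_filter:
  assumes P: "prime_ideal D P"
    and "\<And>y. y \<in> set ys \<Longrightarrow> y \<in> D \<and> y \<noteq> 0 \<and> (\<not> p y \<longrightarrow> y \<notin> P)"
  shows "assoc_at P (prod_list ys) (prod_list (filter p ys))"
  using assms(2)
proof (induction ys)
  case Nil
  then show ?case using assoc_at_refl[OF P] by simp
next
  case (Cons y ys)
  then have IH: "assoc_at P (prod_list ys) (prod_list (filter p ys))" by simp
  show ?case
  proof (cases "p y")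
    case True
    then show ?thesis using assoc_at_mult[OF P assoc_at_refl[OF P] IH] Cons.prems by simp
  next
    case False
    then have "assoc_at P y 1" using assoc_at_unit[OF P] Cons.prems by simp
    then show ?thesis using assoc_at_mult[OF P _ IH] False by fastforce
  qed
qed

text \<open>Such an element is a local unit away from at most one place, so putting it into a
  product changes the product at that place only. Units of \<open>D\<close> are included.\<close>

definition at_most_one_max :: "'a \<Rightarrow> bool" where
  "at_most_one_max y \<longleftrightarrow> y \<in> D \<and> y \<noteq> 0 \<and>
     (\<forall>P Q. max_star_ideal D st P \<and> max_star_ideal D st Q \<and> y \<in> P \<and> y \<in> Q \<longrightarrow> P = Q)"

lemma prod_list_concat_replicate:
  "prod_list (concat (replicate n ys)) = prod_list ys ^ n" for ys :: "'a list"
  by (induction n) auto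

text \<open>Some power of each factor \<open>I\<close> has a principal closure \<open>zD\<close>,
  and \<open>z\<close> lies only in maximal star-ideals containing \<open>I\<close>, of which there
  is at most one. The exponents of head and tail are multiplied to obtain a common one.\<close>

lemma power_factorization:
  assumes "\<And>I. I \<in> set Is \<Longrightarrow> star_af_homog D st I"
  shows "\<exists>N\<ge>1. \<exists>ys. (\<forall>y\<in>set ys. at_most_one_max y) \<and>
    (\<forall>P g. max_star_ideal D st P \<and> generates_at P (ideal_prod_list D Is) g
       \<longrightarrow> assoc_at P (g ^ N) (prod_list ys))"
  using assms
proof (induction Is)
  case Nil
  have "assoc_at P (g ^ 1) (prod_list [])"
    if "max_star_ideal D st P" "generates_at P (ideal_prod_list D []) g" for P g
    using that generates_at_unique[OF max_prime] generates_at_D[OF max_prime]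
    by (auto simp: ideal_prod_list_def)
  then show ?case by (intro exI[of _ 1] conjI exI[of _ "[]"]) auto
next
  case (Cons I Is)
  have I: "star_af_homog D st I" using Cons.prems by simp
  obtain N ys where IH: "N \<ge> 1" "\<And>y. y \<in> set ys \<Longrightarrow> at_most_one_max y"
    "\<And>P g. max_star_ideal D st P \<Longrightarrow> generates_at P (ideal_prod_list D Is) g
       \<Longrightarrow> assoc_at P (g ^ N) (prod_list ys)"
    using Cons by (metis list.set_intros(2))
  obtain n z where n: "n \<ge> 1" and z: "st (ideal_pow D I n) = principal z D"
    using I af_homogD[OF I] unfolding star_af_homog_def star_ideal_def by blast
  have fr: "frac_ideal D (ideal_pow D I n)" using af_homogD(1)[OF I] by (rule frac_ideal_pow)
  have z0: "z \<noteq> 0" using principal_nonzero[OF fr z] .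
  have sub: "ideal_pow D I n \<subseteq> D" using af_homogD(3)[OF I]
    unfolding ideal_pow_def by (intro ideal_prod_list_subset) simp
  then have "principal z D \<subseteq> D" using st_subset[OF fr frac_ideal_D st_D] z by simp
  then have zD: "z \<in> D" using mem_principal[OF z0, of z] z0 by auto
  \<comment> \<open>The \<open>n\<close>-th power of \<open>I\<close> lies in \<open>zD\<close>,
    hence in \<open>P\<close>, and \<open>P\<close> is prime.\<close>
  have zP: "I \<subseteq> P" if P: "max_star_ideal D st P" "z \<in> P" for P
  proof -
    have "ideal_pow D I n \<subseteq> principal z D" using st_extensive[OF fr] z by simp
    also have "\<dots> \<subseteq> P"
      using prime_facts(6)[OF max_prime[OF P(1)] _ P(2)] by (auto simp: principal_def mult.commute)
    finally show ?thesis
      using prime_contains_factor[OF max_prime[OF P(1)], of "replicate n I"] af_homogD(3)[OF I]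
      unfolding ideal_pow_def by (auto split: if_splits)
  qed
  have zgood: "at_most_one_max z" unfolding at_most_one_max_def
    using zD z0 zP af_homog_unique_max[OF I] by blast
  \<comment> \<open>The exponent \<open>n * N\<close> raises the \<open>n\<close>-th power of the
    head to \<open>N\<close> and the \<open>N\<close>-th power of the tail to \<open>n\<close>,
    which gives these multiplicities.\<close>
  define zs where "zs = replicate N z @ concat (replicate n ys)"
  have prod: "prod_list zs = z ^ N * prod_list ys ^ n"
    by (simp add: zs_def prod_list_concat_replicate)
  have "\<forall>y\<in>set zs. at_most_one_max y" using zgood IH(2) by (auto simp: zs_def split: if_splits)
  moreover have "assoc_at P (g ^ (n * N)) (prod_list zs)"
    if P: "max_star_ideal D st P" and g: "generates_at P (ideal_prod_list D (I # Is)) g" for P g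
  proof -
    note pr = max_prime[OF P]
    obtain h where h: "generates_at P I h" using af_homog_generates[OF I P] by blast
    obtain k where k: "generates_at P (ideal_prod_list D Is) k"
      using af_homog_prod_generates[OF _ P] Cons.prems by (metis list.set_intros(2))
    have "assoc_at P g (h * k)"
      using g generates_at_mult[OF pr h k] generates_at_unique[OF pr] unfolding ideal_prod_list_Cons by blast
    then have "assoc_at P (g ^ (n * N)) ((h * k) ^ (n * N))" by (rule assoc_at_power[OF pr])
    moreover have "(h * k) ^ (n * N) = (h ^ n) ^ N * (k ^ N) ^ n"
      by (simp add: power_mult_distrib flip: power_mult) (simp add: mult.commute)
    moreover have "assoc_at P (h ^ n) z"
      using generates_at_pow[OF pr h] st_principal_iff[OF fr z0] z P generates_at_unique[OF pr] by blast
    then have "assoc_at P ((h ^ n) ^ N * (k ^ N) ^ n) (prod_list zs)" unfolding prod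
      using IH(3)[OF P k] by (intro assoc_at_mult[OF pr] assoc_at_power[OF pr])
    ultimately show ?thesis using assoc_at_trans[OF pr] by metis
  qed
  ultimately show ?case using n IH(1) by (intro exI[of _ "n * N"] conjI exI[of _ zs]) auto
qed

section \<open>Valuation localizations, local finiteness, independence and the almost GCD
  property\<close>

context
  assumes factor: "\<And>x. x \<in> D \<Longrightarrow> x \<noteq> 0 \<Longrightarrow>
    \<exists>Is. (\<forall>I\<in>set Is. star_af_homog D st I) \<and> principal x D = st (ideal_prod_list D Is)"
begin

lemma factorE:
  assumes "x \<in> D" "x \<noteq> 0"
  obtains Is where "\<And>I. I \<in> set Is \<Longrightarrow> star_af_homog D st I"
    "\<And>P. max_star_ideal D st P \<Longrightarrow> generates_at P (ideal_prod_list D Is) x"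
    "ideal_prod_list D Is \<subseteq> principal x D"
proof -
  obtain Is where Is: "\<And>I. I \<in> set Is \<Longrightarrow> star_af_homog D st I" "principal x D = st (ideal_prod_list D Is)"
    using factor[OF assms] by blast
  have fr: "frac_ideal D (ideal_prod_list D Is)" 
    using Is(1) by (intro frac_ideal_prod_list af_homogD(1))
  show ?thesis
    using that[OF Is(1)] st_principal_iff[OF fr assms(2)] st_extensive[OF fr] Is(2) by simp
qed

text \<open>Write \<open>z\<close> as \<open>b * z\<close> over \<open>b\<close>, both in
  \<open>D\<close>. The factorization of \<open>b\<close> makes it locally associated with a
  comparable element, so \<open>b\<close> and \<open>b * z\<close> are comparable.\<close>

lemma valuation_of_factor:
  assumes P: "max_star_ideal D st P"
  shows "valuation_domain (loc P)"
  unfolding valuation_domain_def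
proof (intro allI impI)
  note pr = max_prime[OF P]
  fix z :: 'a assume z: "z \<noteq> 0"
  obtain b where b: "b \<in> D" "b \<noteq> 0" "b * z \<in> D" by (rule denominator)
  obtain Is where Is: "\<And>I. I \<in> set Is \<Longrightarrow> star_af_homog D st I"
    "generates_at P (ideal_prod_list D Is) b"
    using factorE[OF b(1,2)] P by metis
  obtain g where g: "generates_at P (ideal_prod_list D Is) g" "comparable_at P g"
    using af_homog_prod_generates[OF Is(1) P] by blast
  have as: "assoc_at P b g" using generates_at_unique[OF pr Is(2) g(1)] .
  have "g / (b * z) \<in> loc P \<or> b * z / g \<in> loc P"
    using g(2) loc_base[OF pr b(3)] b z unfolding comparable_at_def by simp
  then have "b / (b * z) \<in> loc P \<or> b * z / b \<in> loc P"
    using as loc_div_trans[OF pr] unfolding assoc_at_def by blast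
  then show "z \<in> loc P \<or> inverse z \<in> loc P" using b by (auto simp: field_simps)
qed

text \<open>A maximal star-ideal containing \<open>x\<close> is prime, so it contains one of the
  finitely many factors, and each factor lies in at most one such ideal.\<close>

lemma locally_finite_of_factor:
  assumes "x \<in> D" "x \<noteq> 0"
  shows "finite {P. max_star_ideal D st P \<and> x \<in> P}"
proof -
  obtain Is where Is: "\<And>I. I \<in> set Is \<Longrightarrow> star_af_homog D st I"
    "ideal_prod_list D Is \<subseteq> principal x D"
    using factorE[OF assms] by metis
  have "{P. max_star_ideal D st P \<and> x \<in> P} \<subseteq> (\<Union>I\<in>set Is. {P. max_star_ideal D st P \<and> I \<subseteq> P})"
  proof
    fix P assume "P \<in> {P. max_star_ideal D st P \<and> x \<in> P}"
    then have P: "max_star_ideal D st P" "x \<in> P" by auto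
    have "principal x D \<subseteq> P"
      using prime_facts(6)[OF max_prime[OF P(1)] _ P(2)] by (auto simp: principal_def mult.commute)
    then have "\<exists>I\<in>set Is. I \<subseteq> P"
      using Is by (intro prime_contains_factor[OF max_prime[OF P(1)]] af_homogD(3)) auto
    then show "P \<in> (\<Union>I\<in>set Is. {P. max_star_ideal D st P \<and> I \<subseteq> P})" using P(1) by blast
  qed
  moreover have "finite {P. max_star_ideal D st P \<and> I \<subseteq> P}" if "I \<in> set Is" for I
  proof (cases "\<exists>P. max_star_ideal D st P \<and> I \<subseteq> P")
    case True
    then obtain Q where "max_star_ideal D st Q" "I \<subseteq> Q" by blast
    then have "{P. max_star_ideal D st P \<and> I \<subseteq> P} \<subseteq> {Q}"
      using af_homog_unique_max[OF Is(1)[OF that]] by blast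
    then show ?thesis by (rule finite_subset) simp
  next
    case False
    then have "{P. max_star_ideal D st P \<and> I \<subseteq> P} = {}" by blast
    then show ?thesis by (metis finite.emptyI)
  qed
  ultimately show ?thesis by (meson finite_UN_I finite_set finite_subset)
qed

text \<open>Factoring a nonzero element of \<open>Q\<close> puts some factor inside the prime
  \<open>Q\<close>, and this factor would lie in two maximal star-ideals.\<close>

lemma independent_of_factor:
  assumes P: "max_star_ideal D st P1" "max_star_ideal D st P2" "P1 \<noteq> P2"
    and Q: "prime_ideal D Q" "Q \<noteq> {0}"
  shows "\<not> (Q \<subseteq> P1 \<and> Q \<subseteq> P2)"
proof
  assume sub: "Q \<subseteq> P1 \<and> Q \<subseteq> P2"
  obtain x where x: "x \<in> Q" "x \<noteq> 0" using Q(2) prime_facts(3)[OF Q(1)] by blast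
  then have "x \<in> D" using prime_facts(2)[OF Q(1)] by blast
  then obtain Is where Is: "\<And>I. I \<in> set Is \<Longrightarrow> star_af_homog D st I"
    "ideal_prod_list D Is \<subseteq> principal x D"
    using factorE x(2) by metis
  have "principal x D \<subseteq> Q"
    using prime_facts(6)[OF Q(1) _ x(1)] by (auto simp: principal_def mult.commute)
  then have "\<exists>I\<in>set Is. I \<subseteq> Q"
    using Is by (intro prime_contains_factor[OF Q(1)] af_homogD(3)) auto
  then obtain I where "I \<in> set Is" "I \<subseteq> Q" by blast
  then show False using af_homog_unique_max[OF Is(1)] sub P by blast
qed

text \<open>The free multiplier \<open>k\<close> allows two elements to be brought to a common
  exponent.\<close>

lemma element_power_factorization:
  assumes "x \<in> D" "x \<noteq> 0"
  shows "\<exists>N\<ge>1. \<forall>k. \<exists>ys. (\<forall>y\<in>set ys. at_most_one_max y) \<and>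
    (\<forall>P. max_star_ideal D st P \<longrightarrow> assoc_at P (x ^ (N * k)) (prod_list ys))"
proof -
  obtain Is where Is: "\<And>I. I \<in> set Is \<Longrightarrow> star_af_homog D st I"
    "\<And>P. max_star_ideal D st P \<Longrightarrow> generates_at P (ideal_prod_list D Is) x"
    using factorE[OF assms] by metis
  obtain N ys where N: "N \<ge> 1" "\<And>y. y \<in> set ys \<Longrightarrow> at_most_one_max y"
    "\<And>P g. max_star_ideal D st P \<Longrightarrow> generates_at P (ideal_prod_list D Is) g
       \<Longrightarrow> assoc_at P (g ^ N) (prod_list ys)"
    using power_factorization[OF Is(1)] by metis
  have "assoc_at P (x ^ (N * k)) (prod_list (concat (replicate k ys)))"
    if "max_star_ideal D st P" for P k
    using assoc_at_power[OF max_prime[OF that] N(3)[OF that Is(2)[OF that]], of k]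
    by (simp add: prod_list_concat_replicate power_mult)
  moreover have "\<forall>y\<in>set (concat (replicate k ys)). at_most_one_max y" for k
    using N(2) by auto
  ultimately show ?thesis using N(1) by blast
qed

text \<open>The element \<open>d\<close> is assembled to be the greatest common divisor of
  \<open>a ^ n\<close> and \<open>b ^ n\<close> at every place; the least common multiple is their
  product divided by \<open>d\<close>.\<close>

lemma almost_GCD_of_factor: "almost_GCD D"
  unfolding almost_GCD_def
proof (intro ballI impI)
  fix a b assume ab: "a \<in> D" "b \<in> D" "a \<noteq> 0 \<and> b \<noteq> 0"
  obtain M where M: "M \<ge> 1" "\<And>k. \<exists>ys. (\<forall>y\<in>set ys. at_most_one_max y) \<and>
    (\<forall>P. max_star_ideal D st P \<longrightarrow> assoc_at P (a ^ (M * k)) (prod_list ys))"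
    using element_power_factorization ab by metis
  obtain N where N: "N \<ge> 1" "\<And>k. \<exists>ys. (\<forall>y\<in>set ys. at_most_one_max y) \<and>
    (\<forall>P. max_star_ideal D st P \<longrightarrow> assoc_at P (b ^ (N * k)) (prod_list ys))"
    using element_power_factorization ab by metis
  \<comment> \<open>A common exponent, reached with multiplier \<open>N\<close> for \<open>a\<close>
    and \<open>M\<close> for \<open>b\<close>.\<close>
  define n where "n = M * N"
  obtain ys where ys: "\<And>y. y \<in> set ys \<Longrightarrow> at_most_one_max y"
    "\<And>P. max_star_ideal D st P \<Longrightarrow> assoc_at P (a ^ n) (prod_list ys)"
    using M(2)[of N] unfolding n_def by blast
  obtain zs where zs: "\<And>y. y \<in> set zs \<Longrightarrow> at_most_one_max y"
    "\<And>P. max_star_ideal D st P \<Longrightarrow> assoc_at P (b ^ n) (prod_list zs)"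
    using N(2)[of M] unfolding n_def by (metis mult.commute)
  \<comment> \<open>\<open>p\<close> selects the factors of \<open>a ^ n\<close> at places where
    \<open>a\<close> divides \<open>b\<close>, and \<open>q\<close> those of \<open>b ^ n\<close> at
    the remaining places. Factors in no maximal star-ideal pass both tests vacuously and are
    harmless units.\<close>
  define p where "p = (\<lambda>y. \<forall>P. max_star_ideal D st P \<and> y \<in> P \<longrightarrow> b / a \<in> loc P)"
  define q where "q = (\<lambda>y. \<forall>P. max_star_ideal D st P \<and> y \<in> P \<longrightarrow> b / a \<notin> loc P)"
  define d where "d = prod_list (filter p ys) * prod_list (filter q zs)"
  have units: "assoc_at P (prod_list ws) 1"
    if "max_star_ideal D st P" "\<And>w. w \<in> set ws \<Longrightarrow> at_most_one_max w \<and> w \<notin> P" for P ws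
    using assoc_at_prod_list_filter[OF max_prime[OF that(1)], of ws "\<lambda>_. False"] that(2)
    by (simp add: at_most_one_max_def)
  have d1: "assoc_at P d (a ^ n)" if P: "max_star_ideal D st P" and "b / a \<in> loc P" for P
  proof -
    note pr = max_prime[OF P]
    have "assoc_at P (prod_list ys) (prod_list (filter p ys))"
    proof (rule assoc_at_prod_list_filter[OF pr])
      fix y assume "y \<in> set ys"
      then have y: "at_most_one_max y" by (rule ys(1))
      have "y \<notin> P" if n: "\<not> p y"
      proof
        assume "y \<in> P"
        obtain Q where "max_star_ideal D st Q" "y \<in> Q" "b / a \<notin> loc Q" using n unfolding p_def by blast
        then show False using y \<open>y \<in> P\<close> P \<open>b / a \<in> loc P\<close> unfolding at_most_one_max_def by blast
      qed
      then show "y \<in> D \<and> y \<noteq> 0 \<and> (\<not> p y \<longrightarrow> y \<notin> P)" using y by (auto simp: at_most_one_max_def)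
    qed
    \<comment> \<open>A factor kept by \<open>q\<close> cannot lie in \<open>P\<close>, since
      \<open>a\<close> divides \<open>b\<close> there.\<close>
    moreover have "assoc_at P (prod_list (filter q zs)) 1"
      using zs(1) that unfolding q_def by (intro units) auto
    then have "assoc_at P 1 (prod_list (filter q zs))" by (rule assoc_at_sym)
    ultimately have "assoc_at P (prod_list ys * 1) d" unfolding d_def
      by (intro assoc_at_mult[OF pr])
    then have "assoc_at P (a ^ n) d" using assoc_at_trans[OF pr ys(2)[OF P]] by simp
    then show ?thesis by (rule assoc_at_sym)
  qed
  have d2: "assoc_at P d (b ^ n)" if P: "max_star_ideal D st P" and "b / a \<notin> loc P" for P
  proof -
    note pr = max_prime[OF P]
    have "assoc_at P (prod_list zs) (prod_list (filter q zs))"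
    proof (rule assoc_at_prod_list_filter[OF pr])
      fix y assume "y \<in> set zs"
      then have y: "at_most_one_max y" by (rule zs(1))
      have "y \<notin> P" if n: "\<not> q y"
      proof
        assume "y \<in> P"
        obtain Q where "max_star_ideal D st Q" "y \<in> Q" "b / a \<in> loc Q" using n unfolding q_def by blast
        then show False using y \<open>y \<in> P\<close> P \<open>b / a \<notin> loc P\<close> unfolding at_most_one_max_def by blast
      qed
      then show "y \<in> D \<and> y \<noteq> 0 \<and> (\<not> q y \<longrightarrow> y \<notin> P)" using y by (auto simp: at_most_one_max_def)
    qed
    moreover have "assoc_at P (prod_list (filter p ys)) 1"
      using ys(1) that unfolding p_def by (intro units) auto
    then have "assoc_at P 1 (prod_list (filter p ys))" by (rule assoc_at_sym)
    ultimately have "assoc_at P (1 * prod_list zs) d" unfolding d_def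
      by (intro assoc_at_mult[OF pr])
    then have "assoc_at P (b ^ n) d" using assoc_at_trans[OF pr zs(2)[OF P]] by simp
    then show ?thesis by (rule assoc_at_sym)
  qed
  have "w \<noteq> 0" if "w \<in> set (filter p ys) \<union> set (filter q zs)" for w
    using that ys(1) zs(1) by (auto simp: at_most_one_max_def)
  then have d0: "d \<noteq> 0" unfolding d_def by (auto simp: prod_list_zero_iff)
  define c where "c = a ^ n * b ^ n / d"
  have nz: "a ^ n \<noteq> 0" "b ^ n \<noteq> 0" "c \<noteq> 0" using ab d0 by (auto simp: c_def)
  have eq: "principal (a ^ n) D \<inter> principal (b ^ n) D = principal c D"
  proof (rule local_lcm[OF nz])
    fix P assume P: "max_star_ideal D st P"
    note pr = max_prime[OF P]
    have num: "assoc_at P (a ^ n * b ^ n) (a ^ n * b ^ n)" using nz by (intro assoc_at_refl[OF pr]) simp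
    show "a ^ n / b ^ n \<in> loc P \<and> assoc_at P c (a ^ n) \<or> b ^ n / a ^ n \<in> loc P \<and> assoc_at P c (b ^ n)"
    proof (cases "b / a \<in> loc P")
      case True
      then have "assoc_at P c (a ^ n * b ^ n / a ^ n)" unfolding c_def
        using num d1[OF P] by (intro assoc_at_divide[OF pr])
      moreover have "a ^ n * b ^ n / a ^ n = b ^ n" using nz by (intro nonzero_mult_div_cancel_left)
      moreover have "(b / a) ^ n \<in> loc P" using True by (rule loc_power[OF pr])
      ultimately show ?thesis by (simp only: power_divide) blast
    next
      case False
      then have "assoc_at P c (a ^ n * b ^ n / b ^ n)" unfolding c_def
        using num d2[OF P] by (intro assoc_at_divide[OF pr])
      moreover have "inverse (b / a) \<in> loc P"
        using False valuation_of_factor[OF P] ab unfolding valuation_domain_def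
        by (metis divide_eq_0_iff)
      then have "(a / b) ^ n \<in> loc P" using loc_power[OF pr] by simp
      moreover have "a ^ n * b ^ n / b ^ n = a ^ n" using nz by (intro nonzero_mult_div_cancel_right)
      ultimately show ?thesis by (simp only: power_divide) blast
    qed
  qed
  have "c \<in> principal (a ^ n) D" using eq mem_principal[OF nz(3), of c] nz(3) by auto
  then have "c \<in> D" using ab by (auto simp: principal_def)
  moreover have "n \<ge> 1" using M(1) N(1) by (simp add: n_def)
  ultimately show "\<exists>n\<ge>1. \<exists>c\<in>D. principal (a ^ n) D \<inter> principal (b ^ n) D = principal c D"
    using eq by blast
qed

end

section \<open>From almost GCD domains to factorizations\<close>

text \<open>Finitely many quotients \<open>s / g\<close> have a common denominator \<open>t\<close>
  outside \<open>P\<close>. Then \<open>t / g\<close> sends the span into \<open>D\<close>, hence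
  also its star closure, so closing up does not enlarge the localization.\<close>

lemma generates_at_st_dspan:
  assumes P: "max_star_ideal D st P" and S: "finite S" and g: "g \<in> S" "g \<noteq> 0"
    and le: "\<And>s. s \<in> S \<Longrightarrow> s / g \<in> loc P"
  shows "generates_at P (st (dspan D S)) g"
proof -
  note pr = max_prime[OF P]
  have fr: "frac_ideal D (dspan D S)" using fg_ideal_dspan[OF S g] by (rule frac_ideal_fg)
  have "\<exists>t\<in>D. t \<notin> P \<and> (\<forall>s\<in>S. t * (s / g) \<in> D)" using S le
  proof (induction S)
    case empty
    then show ?case using prime_facts(4)[OF pr] by (intro bexI[of _ 1]) auto
  next
    case (insert s S)
    then obtain t where t: "t \<in> D" "t \<notin> P" "\<forall>s\<in>S. t * (s / g) \<in> D" by auto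
    obtain u where u: "u \<in> D" "u \<notin> P" "u * (s / g) \<in> D" using mem_loc[OF pr] insert.prems by blast
    have "t * u * (r / g) \<in> D" if "r \<in> insert s S" for r
    proof -
      have "t * (u * (r / g)) \<in> D \<or> u * (t * (r / g)) \<in> D"
        using that t u D_closed(5) by blast
      then show ?thesis by (simp add: mult_ac)
    qed
    moreover have "t * u \<notin> P" using prime_facts(5)[OF pr] t u by blast
    ultimately show ?case using t u by (intro bexI[of _ "t * u"]) auto
  qed
  then obtain t where t: "t \<in> D" "t \<notin> P" "\<And>s. s \<in> S \<Longrightarrow> t * (s / g) \<in> D" by blast
  have t0: "t / g \<noteq> 0" using t(2) g(2) prime_facts(3)[OF pr] by auto
  have "dspan D S \<subseteq> {z. t / g * z \<in> D}"
    using t(3) by (intro dspan_subset[OF submodule_scaled[OF submodule_D]]) auto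
  then have "t / g * i \<in> D" if "i \<in> st (dspan D S)" for i
    using that by (intro st_scaled_mem[OF fr frac_ideal_D st_D t0, of i]) auto
  then have "i / g \<in> loc P" if "i \<in> st (dspan D S)" for i
    unfolding mem_loc[OF pr] using t that by (intro bexI[of _ t]) auto
  moreover have "g \<in> st (dspan D S)" using subset_dspan[OF S] st_extensive[OF fr] g(1) by blast
  moreover have "g / g \<in> loc P" using g(2) loc_base[OF pr] by simp
  ultimately show ?thesis unfolding generates_at_def using g(2) by blast
qed

text \<open>Converse passage to \<open>local_lcm\<close>: clearing \<open>A / B\<close> by a
  denominator \<open>s\<close> outside \<open>P\<close> puts \<open>s * A\<close> into the
  intersection, so \<open>c\<close> divides \<open>A\<close> up to the local unit
  \<open>s\<close>.\<close>

lemma assoc_at_lcm: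
  assumes P: "prime_ideal D P" and nz: "A \<noteq> 0" "B \<noteq> 0" "c \<noteq> 0"
    and eq: "principal A D \<inter> principal B D = principal c D" and le: "A / B \<in> loc P"
  shows "assoc_at P c A"
proof -
  have "c \<in> principal c D" using mem_principal[OF nz(3), of c] nz(3) by simp
  then have "c / A \<in> D" using eq mem_principal[OF nz(1)] by blast
  moreover obtain s where s: "s \<in> D" "s \<notin> P" "s * (A / B) \<in> D" using le mem_loc[OF P] by blast
  have "s * A \<in> principal A D \<inter> principal B D" using s nz mem_principal by simp
  then have "s * (A / c) \<in> D" using eq mem_principal[OF nz(3)] by simp
  then have "A / c \<in> loc P" using s mem_loc[OF P] by blast
  ultimately show ?thesis unfolding assoc_at_def using nz loc_base[OF P] by blast
qed

section \<open>Principal powers of finite type ideals in almost GCD domains\<close>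

context
  assumes gcd: "almost_GCD D"
    and val: "\<And>P. max_star_ideal D st P \<Longrightarrow> valuation_domain (loc P)"
begin

text \<open>Induction on the generators. The generator \<open>g\<close> dividing all others varies
  with \<open>P\<close>, but \<open>d\<close> and \<open>n\<close> are global. A new generator
  \<open>b\<close> is absorbed by replacing \<open>d\<close> with a greatest common divisor of
  powers of \<open>d\<close> and \<open>b ^ n\<close>.\<close>

lemma fg_power_principal_local:
  assumes "finite S" "\<exists>s\<in>S. s \<noteq> 0"
  shows "\<exists>n\<ge>1. \<exists>d. d \<noteq> 0 \<and> (\<forall>P. max_star_ideal D st P \<longrightarrow>
    (\<exists>g\<in>S. g \<noteq> 0 \<and> (\<forall>s\<in>S. s / g \<in> loc P) \<and> assoc_at P d (g ^ n)))"
  using assms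
proof (induction S)
  case empty
  then show ?case by simp
next
  case (insert b S)
  show ?case
  proof (cases "\<exists>s\<in>S. s \<noteq> 0")
    case False
    then have b: "b \<noteq> 0" using insert.prems by blast
    have "s / b \<in> loc P" if "max_star_ideal D st P" "s \<in> insert b S" for P s
      using loc_base[OF max_prime[OF that(1)]] that(2) False b by auto
    moreover have "assoc_at P b (b ^ 1)" if "max_star_ideal D st P" for P
      using assoc_at_refl[OF max_prime[OF that] b] by simp
    ultimately show ?thesis using b by (intro exI[of _ 1] conjI exI[of _ b]) blast+
  next
    case True
    then obtain n d where n: "n \<ge> 1" "d \<noteq> 0" and IH: "\<And>P. max_star_ideal D st P \<Longrightarrow>
      \<exists>g\<in>S. g \<noteq> 0 \<and> (\<forall>s\<in>S. s / g \<in> loc P) \<and> assoc_at P d (g ^ n)"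
      using insert.IH by metis
    show ?thesis
    proof (cases "b = 0")
      case True
      have "\<exists>g\<in>insert b S. g \<noteq> 0 \<and> (\<forall>s\<in>insert b S. s / g \<in> loc P) \<and> assoc_at P d (g ^ n)"
        if P: "max_star_ideal D st P" for P
        using IH[OF P] loc_base[OF max_prime[OF P], of 0] True by auto
      then show ?thesis using n by blast
    next
      case False
      \<comment> \<open>The almost GCD property concerns elements of \<open>D\<close>, so
        \<open>d\<close> and \<open>b ^ n\<close> are first scaled into \<open>D\<close>.\<close>
      obtain e where e: "e \<in> D" "e \<noteq> 0" "e * d \<in> D" "e * b ^ n \<in> D"
        using common_denominator[of "{d, b ^ n}"] by auto
      have nz: "e * d \<noteq> 0" "e * b ^ n \<noteq> 0" using e n False by auto
      obtain m c where m: "m \<ge> 1" and c: "principal ((e * d) ^ m) D \<inter> principal ((e * b ^ n) ^ m) D = principal c D"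
        using gcd e nz unfolding almost_GCD_def by metis
      define A where "A = (e * d) ^ m"
      define B where "B = (e * b ^ n) ^ m"
      have AB: "A \<noteq> 0" "B \<noteq> 0" "A \<in> D" "B \<in> D" using e nz by (auto simp: A_def B_def)
      note c = c[folded A_def B_def]
      have "A * B \<in> principal c D" using c mem_principal AB by auto
      then have c0: "c \<noteq> 0" using AB by (auto simp: principal_def)
      \<comment> \<open>Product over least common multiple gives a greatest common divisor of
        \<open>A\<close> and \<open>B\<close>; dividing by \<open>e ^ m\<close> undoes the
        scaling.\<close>
      define d' where "d' = A * B / c / e ^ m"
      have d'0: "d' \<noteq> 0" using AB c0 e by (simp add: d'_def)
      have "\<exists>g\<in>insert b S. g \<noteq> 0 \<and> (\<forall>s\<in>insert b S. s / g \<in> loc P) \<and> assoc_at P d' (g ^ (n * m))"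
        if P: "max_star_ideal D st P" for P
      proof -
        note pr = max_prime[OF P]
        obtain g where g: "g \<in> S" "g \<noteq> 0" "\<forall>s\<in>S. s / g \<in> loc P" "assoc_at P d (g ^ n)"
          using IH[OF P] by blast
        have AB_refl: "assoc_at P (A * B) (A * B)" using AB by (intro assoc_at_refl[OF pr]) simp
        have e_refl: "assoc_at P (e ^ m) (e ^ m)" using e by (intro assoc_at_refl[OF pr]) simp
        have "b / g \<noteq> 0" using False g by simp
        then consider "b / g \<in> loc P" | "g / b \<in> loc P"
          using val[OF P] unfolding valuation_domain_def by fastforce
        then show ?thesis
        proof cases
          case 1
          \<comment> \<open>Here \<open>g\<close> divides \<open>b\<close>, so it remains the
            generator; \<open>c\<close> is associated with \<open>B\<close>, which leaves
            \<open>d ^ m\<close> for \<open>d'\<close>.\<close>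
          have "b ^ n / g ^ n \<in> loc P" using loc_power[OF pr 1, of n] by (simp add: power_divide)
          moreover have "g ^ n / d \<in> loc P" using g(4) by (simp add: assoc_at_def)
          ultimately have "b ^ n / d \<in> loc P" using g(2) loc_div_trans[OF pr] by fastforce
          then have "B / A \<in> loc P" using loc_power[OF pr, of "b ^ n / d" m] e(2)
            by (simp add: A_def B_def power_divide power_mult_distrib)
          then have "assoc_at P c B"
            using c AB c0 by (intro assoc_at_lcm[OF pr AB(2,1)]) auto
          then have "assoc_at P d' (A * B / B / e ^ m)" unfolding d'_def
            by (intro assoc_at_divide[OF pr] AB_refl e_refl)
          moreover have "A * B / B / e ^ m = d ^ m"
            using AB e by (simp add: A_def power_mult_distrib)
          moreover have "assoc_at P (d ^ m) (g ^ (n * m))"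
            using assoc_at_power[OF pr g(4), of m] by (simp add: power_mult)
          ultimately have "assoc_at P d' (g ^ (n * m))" using assoc_at_trans[OF pr] by metis
          then show ?thesis using g 1 by blast
        next
          case 2
          \<comment> \<open>Here \<open>b\<close> divides \<open>g\<close> and takes over as the
            generator; \<open>c\<close> is associated with \<open>A\<close>.\<close>
          have "g ^ n / b ^ n \<in> loc P" using loc_power[OF pr 2, of n] by (simp add: power_divide)
          moreover have "d / g ^ n \<in> loc P" using g(4) by (simp add: assoc_at_def)
          ultimately have "d / b ^ n \<in> loc P" using g(2) loc_div_trans[OF pr] by fastforce
          then have "A / B \<in> loc P" using loc_power[OF pr, of "d / b ^ n" m] e(2)
            by (simp add: A_def B_def power_divide power_mult_distrib)
          then have "assoc_at P c A"
            using c AB c0 by (intro assoc_at_lcm[OF pr AB(1,2)]) auto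
          then have "assoc_at P d' (A * B / A / e ^ m)" unfolding d'_def
            by (intro assoc_at_divide[OF pr] AB_refl e_refl)
          moreover have "A * B / A / e ^ m = b ^ (n * m)"
            using AB e by (simp add: B_def power_mult_distrib power_mult)
          ultimately have "assoc_at P d' (b ^ (n * m))" by simp
          moreover have "s / b \<in> loc P" if "s \<in> insert b S" for s
          proof (cases "s = b")
            case True
            then show ?thesis using False loc_base[OF pr, of 1] by simp
          next
            case False
            then show ?thesis using that g(2,3) 2 loc_div_trans[OF pr] by blast
          qed
          ultimately show ?thesis using False by blast
        qed
      qed
      moreover have "n * m \<ge> 1" using n m by simp
      ultimately show ?thesis using d'0 by blast
    qed
  qed
qed

lemma finite_type_power_principal:
  assumes "finite_type D st J"
  shows "\<exists>n\<ge>1. \<exists>x. st (ideal_pow D J n) = principal x D"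
proof -
  obtain S where S: "finite S" "fg_ideal D (dspan D S)" "J = st (dspan D S)"
    using assms unfolding finite_type_def fg_ideal_def by blast
  have fr: "frac_ideal D (dspan D S)" using S(2) by (rule frac_ideal_fg)
  have "\<exists>s\<in>S. s \<noteq> 0"
  proof (rule ccontr)
    assume "\<not> ?thesis"
    then have "dspan D S \<subseteq> {0}" by (intro dspan_subset) (auto simp: submodule_def)
    then show False using frac_ideal_nonzero[OF fr] by blast
  qed
  then obtain n d where n: "n \<ge> 1" "d \<noteq> 0" and d: "\<And>P. max_star_ideal D st P \<Longrightarrow>
      \<exists>g\<in>S. g \<noteq> 0 \<and> (\<forall>s\<in>S. s / g \<in> loc P) \<and> assoc_at P d (g ^ n)"
    using fg_power_principal_local[OF S(1)] by metis
  have "generates_at P (ideal_pow D J n) d" if P: "max_star_ideal D st P" for P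
  proof -
    obtain g where g: "g \<in> S" "g \<noteq> 0" "\<And>s. s \<in> S \<Longrightarrow> s / g \<in> loc P" "assoc_at P d (g ^ n)"
      using d[OF P] by blast
    have "generates_at P J g" unfolding S(3) using generates_at_st_dspan[OF P S(1) g(1-3)] .
    then show ?thesis
      using generates_at_assoc[OF max_prime[OF P] generates_at_pow[OF max_prime[OF P]] assoc_at_sym[OF g(4)]] by blast
  qed
  moreover have "frac_ideal D (ideal_pow D J n)" unfolding S(3) by (intro frac_ideal_pow st_frac fr)
  ultimately have "st (ideal_pow D J n) = principal d D" using st_principal_iff n(2) by blast
  then show ?thesis using n(1) by blast
qed

text \<open>A proper integral star-ideal above the closure lies in some maximal star-ideal, which
  can only be \<open>P\<close>. Sums of two such ideals therefore stay in \<open>P\<close>. The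
  condition on powers comes from \<open>finite_type_power_principal\<close>.\<close>

lemma af_homog_of_unique_max:
  assumes J: "finite S" "s \<in> S" "s \<noteq> 0" "S \<subseteq> P" and P: "max_star_ideal D st P"
    and uniq: "\<And>Q. max_star_ideal D st Q \<Longrightarrow> S \<subseteq> Q \<Longrightarrow> Q = P"
  shows "star_af_homog D st (st (dspan D S))"
proof -
  have fg: "fg_ideal D (dspan D S)" using J by (intro fg_ideal_dspan)
  have fr: "frac_ideal D (dspan D S)" using fg by (rule frac_ideal_fg)
  have sub: "dspan D S \<subseteq> P"
    using J(4) by (intro dspan_subset[OF submodule_frac_ideal[OF max_facts(1)[OF P]]])
  have le: "st (dspan D S) \<subseteq> P" by (rule st_subset[OF fr max_facts(1,2)[OF P] sub])
  have "dspan D S \<subseteq> D" using sub max_facts(3)[OF P] by blast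
  then have int: "integral_star_ideal D st (st (dspan D S))" by (rule integral_star_st[OF fr])
  have ne: "st (dspan D S) \<noteq> D" using le max_facts(3,4)[OF P] by blast
  have ft: "finite_type D st (st (dspan D S))" using fg by (auto simp: finite_type_def)
  have inP: "A \<subseteq> P" if A: "integral_star_ideal D st A" "A \<noteq> D" "st (dspan D S) \<subseteq> A" for A
  proof -
    obtain Q where Q: "max_star_ideal D st Q" "A \<subseteq> Q" using exists_max_star_ideal[OF A(1,2)] by blast
    have "S \<subseteq> Q" using subset_dspan[OF J(1)] st_extensive[OF fr] A(3) Q(2) by blast
    then show ?thesis using uniq Q by blast
  qed
  have "st (ideal_add A B) \<noteq> D"
    if A: "integral_star_ideal D st A" "A \<noteq> D" "st (dspan D S) \<subseteq> A"
      and B: "integral_star_ideal D st B" "B \<noteq> D" "st (dspan D S) \<subseteq> B" for A B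
  proof -
    have f: "frac_ideal D A" "A \<subseteq> D" "frac_ideal D B" "B \<subseteq> D"
      using A(1) B(1) by (auto simp: integral_star_ideal_def star_ideal_def)
    have fAB: "frac_ideal D (ideal_add A B)"
      using f submodule_frac_ideal by (intro frac_ideal_add_integral)
    have "ideal_add A B \<subseteq> P"
      using inP A B by (intro ideal_add_least[OF submodule_frac_ideal[OF max_facts(1)[OF P]]])
    then have "st (ideal_add A B) \<subseteq> P" by (rule st_subset[OF fAB max_facts(1,2)[OF P]])
    then show ?thesis using max_facts(3,4)[OF P] by blast
  qed
  then have "star_homog D st (st (dspan D S))" unfolding star_homog_def using int ne ft by blast
  then show ?thesis unfolding star_af_homog_def using finite_type_power_principal by blast
qed

section \<open>Factors supported at one place, and factorization of elements\<close>

context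
  assumes lf: "\<And>x. x \<in> D \<Longrightarrow> x \<noteq> 0 \<Longrightarrow> finite {P. max_star_ideal D st P \<and> x \<in> P}"
    and indep: "\<And>P1 P2 Q. max_star_ideal D st P1 \<Longrightarrow> max_star_ideal D st P2 \<Longrightarrow> P1 \<noteq> P2 \<Longrightarrow>
      prime_ideal D Q \<Longrightarrow> Q \<noteq> {0} \<Longrightarrow> \<not> (Q \<subseteq> P1 \<and> Q \<subseteq> P2)"
begin

text \<open>If \<open>xD\<close> misses the multiplicative set generated by the complements of \<open>P\<close> and \<open>Q\<close>,
  a prime containing \<open>x\<close> and disjoint from this set lies in both \<open>P\<close> and \<open>Q\<close>.\<close>

lemma independent_witness:
  assumes P: "max_star_ideal D st P" and Q: "max_star_ideal D st Q" and ne: "P \<noteq> Q"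
    and x: "x \<in> P" "x \<noteq> 0"
  shows "\<exists>y\<in>P. y \<notin> Q \<and> y / x \<in> loc P"
proof (rule ccontr)
  assume n: "\<not> ?thesis"
  note pP = max_prime[OF P] and pQ = max_prime[OF Q]
  have xD: "x \<in> D" using x(1) max_facts(3)[OF P] by blast
  define M where "M = {s * t | s t. s \<in> D \<and> s \<notin> P \<and> t \<in> D \<and> t \<notin> Q}"
  \<comment> \<open>From \<open>x * d = s * t\<close> the element \<open>t\<close> would be the
    witness sought: \<open>s\<close> is outside \<open>P\<close>, so \<open>t\<close> is in
    \<open>P\<close>, and \<open>t / x\<close> equals \<open>d / s\<close>.\<close>
  have xM: "principal x D \<inter> M = {}"
  proof (rule ccontr)
    assume "\<not> ?thesis"
    then obtain d s t where *: "d \<in> D" "s \<in> D" "s \<notin> P" "t \<in> D" "t \<notin> Q" "x * d = s * t"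
      by (auto simp: M_def principal_def)
    have "d * x \<in> P" using prime_facts(6)[OF pP *(1) x(1)] .
    then have "t \<in> P" using prime_facts(5)[OF pP *(2,4)] * by (simp add: mult.commute)
    moreover have "s * (t / x) = d" using *(6) x(2) by (simp add: field_simps)
    then have "t / x \<in> loc P" unfolding mem_loc[OF pP] using * by auto
    ultimately show False using n * by blast
  qed
  \<comment> \<open>As 1 lies outside both ideals, \<open>M\<close> contains both complements, so a
    prime missing \<open>M\<close> lies in \<open>P\<close> and in \<open>Q\<close>.\<close>
  have one: "1 \<in> D \<and> 1 \<notin> P \<and> 1 \<notin> Q" using prime_facts(4)[OF pP] prime_facts(4)[OF pQ] by simp
  have M1: "s * 1 \<in> M" if "s \<in> D" "s \<notin> P" for s using that one unfolding M_def by blast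
  have M2: "1 * t \<in> M" if "t \<in> D" "t \<notin> Q" for t using that one unfolding M_def by blast
  have mult: "a * b \<in> M" if ab: "a \<in> M" "b \<in> M" for a b
  proof -
    obtain s t where st: "s \<in> D" "s \<notin> P" "t \<in> D" "t \<notin> Q" "a = s * t" using ab(1) by (auto simp: M_def)
    obtain u v where uv: "u \<in> D" "u \<notin> P" "v \<in> D" "v \<notin> Q" "b = u * v" using ab(2) by (auto simp: M_def)
    have "s * u \<in> D" "t * v \<in> D" using st uv by auto
    moreover have "s * u \<notin> P" "t * v \<notin> Q"
      using prime_facts(5)[OF pP] prime_facts(5)[OF pQ] st uv by blast+
    moreover have "a * b = (s * u) * (t * v)" using st uv by (simp add: mult_ac)
    ultimately show ?thesis unfolding M_def by blast
  qed
  have "1 \<in> M" using M1[of 1] one by simp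
  moreover have "principal x D \<subseteq> D" using xD by (auto simp: principal_def)
  ultimately obtain R where R: "prime_ideal D R" "principal x D \<subseteq> R" "R \<inter> M = {}"
    using prime_disjoint_multiplicative[OF _ mult submodule_principal _ xM] by blast
  have "x \<in> R" using R(2) mem_principal[OF x(2), of x] x(2) by auto
  then have "R \<noteq> {0}" using x(2) by blast
  moreover have "R \<subseteq> P" "R \<subseteq> Q" using R(3) M1 M2 prime_facts(2)[OF R(1)] by fastforce+
  ultimately show False using indep[OF P Q ne R(1)] by blast
qed

text \<open>The witnesses adjoined to \<open>x\<close> are multiples of it at \<open>P\<close>, so
  \<open>x\<close> still generates there. At another place containing \<open>x\<close> some witness
  is a unit; at a place not containing \<open>x\<close>, the element \<open>x\<close> itself
  is.\<close>

lemma local_factor: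
  assumes P: "max_star_ideal D st P" and x: "x \<in> P" "x \<noteq> 0"
  shows "\<exists>J. star_af_homog D st J \<and> generates_at P J x \<and>
    (\<forall>Q. max_star_ideal D st Q \<and> Q \<noteq> P \<longrightarrow> generates_at Q J 1)"
proof -
  have xD: "x \<in> D" using x(1) max_facts(3)[OF P] by blast
  define M where "M = {Q. max_star_ideal D st Q \<and> x \<in> Q} - {P}"
  have "\<forall>Q\<in>M. \<exists>y\<in>P. y \<notin> Q \<and> y / x \<in> loc P"
    unfolding M_def using independent_witness[OF P _ _ x] by blast
  then obtain y where y: "\<And>Q. Q \<in> M \<Longrightarrow> y Q \<in> P \<and> y Q \<notin> Q \<and> y Q / x \<in> loc P" by metis
  define S where "S = insert x (y ` M)"
  have S: "finite S" "x \<in> S" "S \<subseteq> P" using lf[OF xD x(2)] x(1) y by (auto simp: S_def M_def)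
  have SD: "S \<subseteq> D" using S(3) max_facts(3)[OF P] by blast
  have out: "\<exists>s\<in>S. s \<notin> Q" if Q: "max_star_ideal D st Q" "Q \<noteq> P" for Q
  proof (cases "x \<in> Q")
    case True
    then have "Q \<in> M" using Q by (simp add: M_def)
    then show ?thesis using y unfolding S_def by blast
  qed (use S in blast)
  have "star_af_homog D st (st (dspan D S))"
    using out by (intro af_homog_of_unique_max[OF S(1,2) x(2) S(3) P]) blast
  moreover have "x / x \<in> loc P" using loc_base[OF max_prime[OF P]] x(2) by simp
  then have "generates_at P (st (dspan D S)) x"
    using y by (intro generates_at_st_dspan[OF P S(1,2) x(2)]) (auto simp: S_def)
  moreover have "generates_at Q (st (dspan D S)) 1" if Q: "max_star_ideal D st Q" "Q \<noteq> P" for Q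
  proof -
    note pr = max_prime[OF Q(1)]
    obtain s where s: "s \<in> S" "s \<notin> Q" using out[OF Q] by blast
    have s0: "s \<noteq> 0" using s(2) prime_facts(3)[OF pr] by auto
    have "r / s \<in> loc Q" if "r \<in> S" for r
      using loc_mult[OF pr loc_base[OF pr] loc_inverse[OF pr]] SD s that
      unfolding divide_inverse by blast
    then have "generates_at Q (st (dspan D S)) s" by (intro generates_at_st_dspan[OF Q(1) S(1) s(1) s0])
    then show ?thesis using generates_at_assoc[OF pr] assoc_at_unit[OF pr] SD s by blast
  qed
  ultimately show ?thesis by blast
qed

text \<open>One factor is taken for each place containing \<open>x\<close>. At such a place its own
  factor contributes \<open>x\<close> and the others 1, and the local-global principle identifies
  the product.\<close>

lemma factorization:
  assumes x: "x \<in> D" "x \<noteq> 0"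
  shows "\<exists>Is. (\<forall>I\<in>set Is. star_af_homog D st I) \<and> principal x D = st (ideal_prod_list D Is)"
proof -
  obtain Ps where Ps: "set Ps = {P. max_star_ideal D st P \<and> x \<in> P}" "distinct Ps"
    using finite_distinct_list[OF lf[OF x]] by blast
  have "\<forall>P\<in>set Ps. \<exists>J. star_af_homog D st J \<and> generates_at P J x \<and>
    (\<forall>Q. max_star_ideal D st Q \<and> Q \<noteq> P \<longrightarrow> generates_at Q J 1)"
    using local_factor x(2) Ps(1) by blast
  then obtain J where J: "\<And>P. P \<in> set Ps \<Longrightarrow> star_af_homog D st (J P) \<and> generates_at P (J P) x \<and>
    (\<forall>Q. max_star_ideal D st Q \<and> Q \<noteq> P \<longrightarrow> generates_at Q (J P) 1)" by metis
  \<comment> \<open>Generalized to sublists for the induction; distinctness keeps \<open>x\<close>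
    from being counted twice at a place.\<close>
  have gen: "generates_at Q (ideal_prod_list D (map J Rs)) (if Q \<in> set Rs then x else 1)"
    if Q: "max_star_ideal D st Q" and "set Rs \<subseteq> set Ps" "distinct Rs" for Q Rs
    using that(2,3)
  proof (induction Rs)
    case Nil
    then show ?case using generates_at_D[OF max_prime[OF Q]] by (simp add: ideal_prod_list_def)
  next
    case (Cons R Rs)
    then have IH: "generates_at Q (ideal_prod_list D (map J Rs)) (if Q \<in> set Rs then x else 1)" by simp
    have "R \<in> set Ps" using Cons.prems by simp
    then have "generates_at Q (J R) (if Q = R then x else 1)" using J Q by simp
    then have "generates_at Q (ideal_prod_list D (map J (R # Rs)))
        ((if Q = R then x else 1) * (if Q \<in> set Rs then x else 1))"
      using generates_at_mult[OF max_prime[OF Q] _ IH] by (simp add: ideal_prod_list_Cons)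
    moreover have "(if Q = R then x else 1) * (if Q \<in> set Rs then x else 1) = (if Q \<in> set (R # Rs) then x else 1)"
      using Cons.prems by auto
    ultimately show ?case by simp
  qed
  have "generates_at Q (ideal_prod_list D (map J Ps)) x" if Q: "max_star_ideal D st Q" for Q
  proof (cases "x \<in> Q")
    case True
    then show ?thesis using gen[OF Q _ Ps(2)] Ps(1) Q by simp
  next
    case False
    then have "generates_at Q (ideal_prod_list D (map J Ps)) 1" using gen[OF Q _ Ps(2)] Ps(1) by simp
    then show ?thesis
      using generates_at_assoc[OF max_prime[OF Q]] assoc_at_unit[OF max_prime[OF Q] x(1) False] assoc_at_sym by blast
  qed
  moreover have "frac_ideal D (ideal_prod_list D (map J Ps))"
    using J af_homogD(1) by (intro frac_ideal_prod_list) auto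
  ultimately have "st (ideal_prod_list D (map J Ps)) = principal x D"
    using st_principal_iff x(2) by blast
  moreover have "\<forall>I\<in>set (map J Ps). star_af_homog D st I" using J by auto
  ultimately show ?thesis by metis
qed

end

end

text \<open>Treats a unit as an empty star-product, so that factorizations become available for
  every nonzero element.\<close>

lemma factor_unit:
  assumes "is_unit_in D x"
  shows "principal x D = st (ideal_prod_list D [])"
proof -
  have x: "x \<in> D" "x \<noteq> 0" "inverse x \<in> D" using assms by (auto simp: is_unit_in_def)
  have "z \<in> principal x D \<longleftrightarrow> z \<in> D" for z
  proof
    assume "z \<in> principal x D"
    then show "z \<in> D" using x by (auto simp: principal_def)
  next
    assume "z \<in> D"
    then show "z \<in> principal x D" using x mem_principal[OF x(2)] by (simp add: divide_inverse)
  qed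
  then show ?thesis by (auto simp: ideal_prod_list_def st_D)
qed

section \<open>Both implications put together\<close>

lemma star_IRKT_alt:
  "star_IRKT D st \<longleftrightarrow>
     (\<forall>P. max_star_ideal D st P \<longrightarrow> valuation_domain (loc P)) \<and>
     (\<forall>x\<in>D. x \<noteq> 0 \<longrightarrow> finite {P. max_star_ideal D st P \<and> x \<in> P}) \<and>
     (\<forall>P1 P2 Q. max_star_ideal D st P1 \<and> max_star_ideal D st P2 \<and> P1 \<noteq> P2 \<and>
        prime_ideal D Q \<and> Q \<noteq> {0} \<longrightarrow> \<not> (Q \<subseteq> P1 \<and> Q \<subseteq> P2))"
proof -
  have "D \<subseteq> \<Inter>{loc P | P. max_star_ideal D st P}" using loc_base[OF max_prime] by blast
  moreover have "\<Inter>{loc P | P. max_star_ideal D st P} \<subseteq> D" using mem_D_local by blast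
  ultimately have "D = \<Inter>{loc P | P. max_star_ideal D st P}" by (rule subset_antisym)
  then have eq: "(D = \<Inter>{loc P | P. max_star_ideal D st P}) = True" by (rule eqTrueI)
  show ?thesis unfolding star_IRKT_def eq simp_thms by (rule TrueI)
qed

theorem af_homog_factorization_iff:
  "(\<forall>x\<in>D. x \<noteq> 0 \<and> \<not> is_unit_in D x \<longrightarrow>
      (\<exists>Is. (\<forall>I\<in>set Is. star_af_homog D st I) \<and> principal x D = st (ideal_prod_list D Is)))
   \<longleftrightarrow> almost_GCD D \<and> star_IRKT D st" (is "?L \<longleftrightarrow> ?R")
proof
  assume L: ?L
  have f: "\<exists>Is. (\<forall>I\<in>set Is. star_af_homog D st I) \<and> principal x D = st (ideal_prod_list D Is)"
    if "x \<in> D" "x \<noteq> 0" for x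
  proof (cases "is_unit_in D x")
    case True
    then show ?thesis using factor_unit by (intro exI[of _ "[]"]) simp
  next
    case False
    then show ?thesis using L that by blast
  qed
  have "star_IRKT D st" unfolding star_IRKT_alt
  proof (intro conjI allI ballI impI)
    fix P assume "max_star_ideal D st P"
    then show "valuation_domain (loc P)" by (intro valuation_of_factor f)
  next
    fix x assume "x \<in> D" "x \<noteq> 0"
    then show "finite {P. max_star_ideal D st P \<and> x \<in> P}" by (intro locally_finite_of_factor f)
  next
    fix P1 P2 Q
    assume "max_star_ideal D st P1 \<and> max_star_ideal D st P2 \<and> P1 \<noteq> P2 \<and> prime_ideal D Q \<and> Q \<noteq> {0}"
    then show "\<not> (Q \<subseteq> P1 \<and> Q \<subseteq> P2)" by (intro independent_of_factor f) simp_all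
  qed
  moreover have "almost_GCD D" by (intro almost_GCD_of_factor f)
  ultimately show ?R by blast
next
  assume R: ?R
  then have "\<exists>Is. (\<forall>I\<in>set Is. star_af_homog D st I) \<and> principal x D = st (ideal_prod_list D Is)"
    if "x \<in> D" "x \<noteq> 0" for x
    using that unfolding star_IRKT_alt by (intro factorization) simp_all
  then show ?L by blast
qed

end

theorem theoremR2:
  fixes D :: "('a::field) set" and st :: "'a set \<Rightarrow> 'a set"
  assumes "is_domain_with_qf D"
    and "star_operation D st"
    and "finite_character D st"
  shows "(\<forall>x\<in>D. x \<noteq> 0 \<and> \<not> is_unit_in D x \<longrightarrow>
            (\<exists>Is. (\<forall>I\<in>set Is. star_af_homog D st I) \<and>
                  principal x D = st (ideal_prod_list D Is)))
         \<longleftrightarrow> (almost_GCD D \<and> star_IRKT D st)"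
proof -
  interpret star_domain D st using assms by unfold_locales
  show ?thesis by (rule af_homog_factorization_iff)
qed

end
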